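(* Fix an integer $k\geq 2$ and let $\theta:=(\log 2-1/e)^{-1}=3.074390\ldots$. Define \[ \mathcal{E}(k):=\left\{\left(\frac{kt}{s}\right)^{\frac{s}{kt}} \;:\; s,t\in\mathbb{N},\ 1\leq t\leq \theta\log k,\ \frac{kt}{e}\leq s\leq kte,\ (kt)^{1/t}\in\mathbb{N},\ s^{1/t}\in\mathbb{N},\ \gcd(kt,s)=1\right\}. \] Then for every algebraic number $A\in[e^{-e},e^{1/e}]$ with $\mathrm{ord}(A)=k$ and $A\notin\mathcal{E}(k)$, the number $h(A)$ is transcendental.
   Context: For a real $x\in[e^{-e},e^{1/e}]$, the sequence $x,\ x^x,\ x^{x^x},\ldots$ (each term being $x$ raised to the previous term) converges; its limit is denoted $h(x)$ (the iterated exponential function). It satisfies $h(x)=x^{h(x)}$ and $1/e\leq h(x)\leq e$. For an algebraic number $A$, $\mathrm{ord}(A):=\min\{n\in\mathbb{N}: A^n\in\mathbb{Q}\}$ if such $n$ exists, and $\mathrm{ord}(A)=\infty$ otherwise. $\mathbb{N}$ denotes the positive integers. *)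

theory Defs
  imports "HOL-Analysis.Analysis" "HOL-Computational_Algebra.Polynomial" "HOL-Library.Extended_Nat"
begin

fun tower :: "real \<Rightarrow> nat \<Rightarrow> real" where
  "tower x 0 = x"
| "tower x (Suc n) = x powr tower x n"

text \<open>Iterated exponential h(x): the limit of the tower (converges for x in [e^-e, e^(1/e)]).\<close>
definition iter_exp :: "real \<Rightarrow> real" where
  "iter_exp x = lim (tower x)"

definition ord_alg :: "real \<Rightarrow> enat" where
  "ord_alg A = (if \<exists>n::nat. n \<ge> 1 \<and> A ^ n \<in> \<rat>
                then enat (LEAST n::nat. n \<ge> 1 \<and> A ^ n \<in> \<rat>) else \<infinity>)"

definition theta :: real where
  "theta = 1 / (ln 2 - 1 / exp 1)"

definition exc_set :: "nat \<Rightarrow> real set" where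
  "exc_set k = {(real (k * t) / real s) powr (real s / real (k * t)) | s t :: nat.
      1 \<le> s \<and> 1 \<le> t \<and> real t \<le> theta * ln (real k)
      \<and> real (k * t) / exp 1 \<le> real s \<and> real s \<le> real (k * t) * exp 1
      \<and> root t (real (k * t)) \<in> \<nat> \<and> root t (real s) \<in> \<nat>
      \<and> gcd (k * t) s = 1}"

end

theory Submission
  imports Defs "Jordan_Normal_Form.Determinant" "HOL-Probability.Characteristic_Functions"
begin

text \<open>
  Suppose \<open>h = iter_exp A\<close> is algebraic and put \<open>r = A ^ k\<close>, a positive rational different from \<open>1\<close>.
  From \<open>h = A powr h\<close> we get \<open>r powr h = h ^ k\<close>. If \<open>h\<close> is irrational this contradicts the
  Gelfond--Schneider theorem, of which only this special case is needed: all numbers involved are real and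
  lie in \<open>\<rat>(h)\<close>. It follows from interpolation determinants (Laurent): the determinant of the functions
  \<open>x ^ a * r powr (b * x)\<close> at the points \<open>m + n * h\<close> is nonzero since a real exponential polynomial
  with \<open>L\<close> coefficients has fewer than \<open>L\<close> real zeros (Rolle), it is small since the functions are
  entire, and it cannot be that small since it is a polynomial in \<open>h\<close> with controlled integer
  coefficients, up to a denominator (Liouville). If \<open>h = a / b\<close> is rational in lowest terms, then
  \<open>A ^ a = h ^ b\<close> gives \<open>a = k * t\<close>, coprimality makes \<open>h\<close> a \<open>t\<close>-th power of a rational, and
  \<open>k * t = c ^ t\<close> with \<open>c \<ge> 2\<close> bounds \<open>t\<close>; so \<open>A\<close> is exceptional.
\<close>

subsection \<open>Determinants of functions of two indices\<close>

text \<open>Taking the entries as a function on all pairs of naturals lets them be rewritten,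
  transposed and cast pointwise, without carrier conditions.\<close>

definition fdet :: "nat \<Rightarrow> (nat \<Rightarrow> nat \<Rightarrow> 'a :: comm_ring_1) \<Rightarrow> 'a" where
  "fdet n M = Determinant.det (mat n n (\<lambda>(i, j). M i j))"

lemma fdet_leibniz:
  "fdet n M = (\<Sum>p | p permutes {0..<n}. signof p * (\<Prod>i = 0..<n. M i (p i)))"
  unfolding fdet_def
  by (subst det_def'[of _ n])
     (auto intro!: sum.cong prod.cong simp: permutes_in_image)

lemma fdet_of_int: "fdet n (\<lambda>i j. real_of_int (M i j)) = real_of_int (fdet n M)"
  unfolding fdet_leibniz by simp

lemma fdet_eq_0_imp_right_kernel:
  fixes M :: "nat \<Rightarrow> nat \<Rightarrow> 'a :: idom"
  assumes "fdet n M = 0"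
  shows "\<exists>u. (\<exists>j<n. u j \<noteq> 0) \<and> (\<forall>i<n. (\<Sum>j<n. M i j * u j) = 0)"
proof -
  obtain v where v: "v \<in> carrier_vec n" "v \<noteq> 0\<^sub>v n"
    "mat n n (\<lambda>(i, j). M i j) *\<^sub>v v = 0\<^sub>v n"
    using det_0_iff_vec_prod_zero[of "mat n n (\<lambda>(i, j). M i j)" n] assms
    unfolding fdet_def by auto
  have "\<exists>j<n. vec_index v j \<noteq> 0"
    using v(1,2) by (metis carrier_vecD eq_vecI index_zero_vec(1) index_zero_vec(2))
  moreover have "(\<Sum>j<n. M i j * vec_index v j) = 0" if "i < n" for i
    using arg_cong[OF v(3), of "\<lambda>w. vec_index w i"] that v(1)
    by (simp add: scalar_prod_def atLeast0LessThan)
  ultimately show ?thesis by (intro exI[of _ "vec_index v"]) auto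
qed

lemma fdet_transpose: "fdet n (\<lambda>i j. M j i) = fdet n M"
proof -
  have "mat n n (\<lambda>(i, j). M j i) = transpose_mat (mat n n (\<lambda>(i, j). M i j))"
    by (intro eq_matI) auto
  then show ?thesis unfolding fdet_def by (simp add: det_transpose[of _ n])
qed

lemma fdet_identical_rows:
  assumes "i < n" "i' < n" "i \<noteq> i'" "\<And>j. j < n \<Longrightarrow> M i j = M i' j"
  shows "fdet n M = 0"
  unfolding fdet_def
  by (rule det_identical_rows[of _ n i i']) (use assms in auto)

text \<open>Multiply on the right by the identity matrix with its first column replaced by
  \<open>v\<close>: it is triangular with determinant \<open>v 0\<close>, and the product has first
  column \<open>\<xi> * v\<close>. This later puts a small factor into one column of an integer
  matrix.\<close>

lemma fdet_eigenvector:
  fixes M :: "nat \<Rightarrow> nat \<Rightarrow> 'a :: idom"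
  assumes n: "0 < n" and ev: "\<And>i. i < n \<Longrightarrow> (\<Sum>j<n. M i j * v j) = \<xi> * v i"
  shows "fdet n M * v 0 = fdet n (\<lambda>i j. if j = 0 then \<xi> * v i else M i j)"
proof -
  let ?A = "mat n n (\<lambda>(i, j). M i j)"
  define P where "P = mat n n (\<lambda>(i, j). if j = 0 then v i else if i = j then 1 else 0)"
  have P: "P \<in> carrier_mat n n" by (simp add: P_def)
  have "Determinant.det P = prod_list (diag_mat P)"
    by (rule det_lower_triangular[OF _ P]) (auto simp: P_def)
  also have "\<dots> = (\<Prod>i = 0..<n. if i = 0 then v 0 else 1)"
    unfolding prod_list_diag_prod by (rule prod.cong) (auto simp: P_def)
  also have "\<dots> = v 0"
    using n by (simp add: prod.delta)
  finally have dP: "Determinant.det P = v 0" .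
  have "?A * P = mat n n (\<lambda>(i, j). if j = 0 then \<xi> * v i else M i j)"
  proof (intro eq_matI)
    fix i j assume "i < dim_row (mat n n (\<lambda>(i, j). if j = 0 then \<xi> * v i else M i j))"
      "j < dim_col (mat n n (\<lambda>(i, j). if j = 0 then \<xi> * v i else M i j))"
    then have ij: "i < n" "j < n" by auto
    have "(?A * P) $$ (i, j) = (\<Sum>l<n. M i l * (if j = 0 then v l else if l = j then 1 else 0))"
      using ij by (simp add: P_def scalar_prod_def atLeast0LessThan)
    also have "\<dots> = (if j = 0 then \<xi> * v i else M i j)"
      using ij ev[of i] by (auto simp: if_distrib[of "\<lambda>x. _ * x"] sum.delta cong: if_cong)
    finally show "(?A * P) $$ (i, j) = mat n n (\<lambda>(i, j). if j = 0 then \<xi> * v i else M i j) $$ (i, j)"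
      using ij by simp
  qed (auto simp: P_def)
  moreover have "Determinant.det (?A * P) = Determinant.det ?A * v 0"
    using det_mult[of ?A n P] P dP by simp
  ultimately show ?thesis unfolding fdet_def by simp
qed

lemma fdet_bound:
  fixes M :: "nat \<Rightarrow> nat \<Rightarrow> real"
  assumes "\<And>i j. i < n \<Longrightarrow> j < n \<Longrightarrow> \<bar>M i j\<bar> \<le> B j"
  shows "\<bar>fdet n M\<bar> \<le> fact n * (\<Prod>j<n. B j)"
proof -
  have *: "\<bar>signof p * (\<Prod>i = 0..<n. M i (p i))\<bar> \<le> (\<Prod>j<n. B j)" if p: "p permutes {0..<n}" for p
  proof -
    have "\<bar>signof p * (\<Prod>i = 0..<n. M i (p i))\<bar> = (\<Prod>i = 0..<n. \<bar>M i (p i)\<bar>)"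
      by (simp add: abs_mult sign_def abs_prod)
    also have "\<dots> \<le> (\<Prod>i = 0..<n. B (p i))"
      using assms permutes_in_image[OF p] by (intro prod_mono) auto
    also have "\<dots> = (\<Prod>j = 0..<n. B j)"
      using prod.permute[OF p, of B] by (simp add: o_def)
    finally show ?thesis by (simp add: atLeast0LessThan)
  qed
  have "\<bar>fdet n M\<bar> \<le> (\<Sum>p | p permutes {0..<n}. \<bar>signof p * (\<Prod>i = 0..<n. M i (p i))\<bar>)"
    unfolding fdet_leibniz by (rule sum_abs)
  also have "\<dots> \<le> of_nat (card {p. p permutes {0..<n}}) * (\<Prod>j<n. B j)"
    by (rule sum_bounded_above) (use * in auto)
  also have "card {p. p permutes {0..<n}} = fact n"
    by (subst card_permutations[of _ n]) auto
  finally show ?thesis by simp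
qed

subsection \<open>Zeros of real exponential polynomials\<close>

text \<open>The points of \<open>Z\<close> are added in increasing order; Rolle's theorem between
  the old maximum and the new point yields a new zero. The last clause keeps the earlier zeros left
  of the old maximum, so the new one is distinct from them.\<close>

lemma rolle_card:
  fixes f :: "real \<Rightarrow> real"
  assumes d: "\<And>x. (f has_real_derivative f' x) (at x)"
    and "finite Z" "\<And>x. x \<in> Z \<Longrightarrow> f x = 0"
  shows "\<exists>Z'. finite Z' \<and> (\<forall>x\<in>Z'. f' x = 0) \<and> card Z \<le> Suc (card Z')
    \<and> (\<forall>x\<in>Z'. \<exists>y\<in>Z. x < y)"
  using assms(2,3)
proof (induction Z rule: finite_linorder_max_induct)
  case empty
  then show ?case by (intro exI[of _ "{}"]) auto
next
  case (insert b Z)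
  then obtain Z' where Z': "finite Z'" "\<And>x. x \<in> Z' \<Longrightarrow> f' x = 0" "card Z \<le> Suc (card Z')"
    "\<And>x. x \<in> Z' \<Longrightarrow> \<exists>y\<in>Z. x < y" by auto
  show ?case
  proof (cases "Z = {}")
    case True
    then show ?thesis by (intro exI[of _ "{}"]) auto
  next
    case False
    define a where "a = Max Z"
    have a: "a \<in> Z" "\<And>y. y \<in> Z \<Longrightarrow> y \<le> a"
      using False insert.hyps(1) by (auto simp: a_def)
    have "a < b" using insert.hyps(2) a(1) by auto
    have "\<exists>z>a. z < b \<and> f' z = 0"
      using Rolle[of a b f] \<open>a < b\<close> insert.prems a(1) d
      by (metis DERIV_unique continuous_on_eq_continuous_at DERIV_isCont insertCI
          real_differentiable_def continuous_at_imp_continuous_on)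
    then obtain z where z: "a < z" "z < b" "f' z = 0" by blast
    have "z \<notin> Z'" using Z'(4) a(2) z(1) by force
    then show ?thesis
      using Z' z insert.hyps
      by (intro exI[of _ "insert z Z'"]) (auto simp: card_insert_if)
  qed
qed

definition exp_poly :: "nat \<Rightarrow> (nat \<Rightarrow> real poly) \<Rightarrow> (nat \<Rightarrow> real) \<Rightarrow> real \<Rightarrow> real" where
  "exp_poly n P w x = (\<Sum>j<n. poly (P j) x * exp (w j * x))"

lemma exp_poly_deriv:
  "(exp_poly n P w has_real_derivative exp_poly n (\<lambda>j. pderiv (P j) + Polynomial.smult (w j) (P j)) w x) (at x)"
  unfolding exp_poly_def
  by (auto intro!: derivative_eq_intros sum.cong simp: algebra_simps)

text \<open>The derivative does not reach the leading coefficient, which is just multiplied by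
  \<open>w\<close>. Hence differentiation never kills a term of nonzero frequency.\<close>

lemma pderiv_add_smult_eq_0_iff:
  fixes p :: "real poly"
  assumes "w \<noteq> 0"
  shows "pderiv p + Polynomial.smult w p = 0 \<longleftrightarrow> p = 0"
proof
  assume *: "pderiv p + Polynomial.smult w p = 0"
  show "p = 0"
  proof (rule ccontr)
    assume "p \<noteq> 0"
    have "coeff (pderiv p + Polynomial.smult w p) (degree p) = w * lead_coeff p"
      by (simp add: coeff_pderiv coeff_eq_0)
    with * \<open>p \<noteq> 0\<close> assms show False by simp
  qed
qed auto

lemma degree_pderiv_add_smult_le:
  fixes p :: "real poly"
  shows "degree (pderiv p + Polynomial.smult w p) \<le> degree p"
  by (intro degree_add_le) (auto simp: degree_pderiv)

text \<open>\<open>T\<close> is the action of differentiation on the coefficient polynomials, and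
  each derivative costs at most one zero.\<close>

lemma exp_poly_iterated_rolle:
  fixes w :: "nat \<Rightarrow> real"
  assumes "finite Z" "\<And>x. x \<in> Z \<Longrightarrow> exp_poly n P w x = 0"
  defines "T \<equiv> \<lambda>P j. pderiv (P j) + Polynomial.smult (w j) (P j)"
  shows "\<exists>Z'. finite Z' \<and> (\<forall>x\<in>Z'. exp_poly n ((T ^^ m) P) w x = 0) \<and> card Z \<le> m + card Z'"
proof (induction m)
  case 0
  then show ?case using assms(1,2) by auto
next
  case (Suc m)
  then obtain Z' where Z': "finite Z'" "\<forall>x\<in>Z'. exp_poly n ((T ^^ m) P) w x = 0"
    "card Z \<le> m + card Z'" by auto
  from rolle_card[OF exp_poly_deriv Z'(1), of n "(T ^^ m) P" w] Z'(2)
  obtain Z'' where "finite Z''" "\<forall>x\<in>Z''. exp_poly n (T ((T ^^ m) P)) w x = 0"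
    "card Z' \<le> Suc (card Z'')" unfolding T_def by blast
  then show ?case using Z'(3) by (intro exI[of _ Z'']) auto
qed

text \<open>Induction on the number of exponentials. Multiplying by \<open>exp (- w n * x)\<close>
  keeps the zeros and turns the last frequency into 0; \<open>D\<close> derivatives then remove the
  last term at the cost of at most \<open>D\<close> zeros, and they neither kill other nonzero terms
  nor raise their degrees.\<close>

lemma card_zeros_exp_poly:
  fixes w :: "nat \<Rightarrow> real"
  assumes "inj_on w {..<n}" "\<And>j. j < n \<Longrightarrow> degree (P j) < D" "\<exists>j<n. P j \<noteq> 0"
    "finite Z" "\<And>x. x \<in> Z \<Longrightarrow> exp_poly n P w x = 0"
  shows "card Z < n * D"
  using assms
proof (induction n arbitrary: P w Z)
  case 0
  then show ?case by auto
next
  case (Suc n)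
  show ?case
  proof (cases "\<exists>j<n. P j \<noteq> 0")
    case False
    then have nz: "P n \<noteq> 0" using Suc.prems(3) by (auto simp: less_Suc_eq)
    have "exp_poly (Suc n) P w x = poly (P n) x * exp (w n * x)" for x
      using False by (simp add: exp_poly_def)
    then have "Z \<subseteq> {x. poly (P n) x = 0}"
      using Suc.prems(5) by auto
    then have "card Z \<le> card {x. poly (P n) x = 0}"
      by (intro card_mono poly_roots_finite nz)
    also have "\<dots> \<le> degree (P n)" by (rule card_poly_roots_bound[OF nz])
    also have "\<dots> < D" using Suc.prems(2) by auto
    finally show ?thesis by simp
  next
    case True
    define v where "v = (\<lambda>j. w j - w n)"
    define T where "T = (\<lambda>P j. pderiv (P j) + Polynomial.smult (v j) (P j :: real poly))"
    have "exp_poly (Suc n) P v x = exp (- w n * x) * exp_poly (Suc n) P w x" for x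
      unfolding exp_poly_def v_def sum_distrib_left
      by (intro sum.cong) (auto simp: algebra_simps exp_minus exp_diff field_simps)
    then have "exp_poly (Suc n) P v x = 0" if "x \<in> Z" for x
      using Suc.prems(5) that by simp
    from exp_poly_iterated_rolle[OF Suc.prems(4) this, of D]
    obtain Z' where Z': "finite Z'" "\<forall>x\<in>Z'. exp_poly (Suc n) ((T ^^ D) P) v x = 0"
      "card Z \<le> D + card Z'" unfolding T_def by auto
    have deg: "degree ((T ^^ m) P j) \<le> degree (P j)" for m j
      by (induction m) (auto simp: T_def intro: order.trans[OF degree_pderiv_add_smult_le])
    \<comment> \<open>Vanishing is carried along because a degree bound of 0 cannot tell a constant
      from the zero polynomial that one more derivative produces.\<close>
    have top: "degree ((T ^^ m) P n) \<le> D - 1 - m \<and> (m \<ge> D \<longrightarrow> (T ^^ m) P n = 0)" for m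
    proof (induction m)
      case 0
      then show ?case using Suc.prems(2)[of n] by auto
    next
      case (Suc m)
      have eq: "(T ^^ Suc m) P n = pderiv ((T ^^ m) P n)" by (simp add: T_def v_def)
      show ?case
      proof (intro conjI impI)
        show "degree ((T ^^ Suc m) P n) \<le> D - 1 - Suc m"
          using Suc unfolding eq degree_pderiv by auto
        show "(T ^^ Suc m) P n = 0" if "D \<le> Suc m"
        proof -
          have "degree ((T ^^ m) P n) = 0" using Suc that by auto
          then show ?thesis unfolding eq by (simp add: pderiv_eq_0_iff)
        qed
      qed
    qed
    have nz: "(T ^^ m) P j = 0 \<longleftrightarrow> P j = 0" if "j < n" for m j
    proof (induction m)
      case (Suc m)
      have "v j \<noteq> 0"
        using Suc.prems that inj_onD[OF \<open>inj_on w {..<Suc n}\<close>, of j n] by (auto simp: v_def)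
      then show ?case using Suc by (simp add: T_def pderiv_add_smult_eq_0_iff)
    qed auto
    have "card Z' < n * D"
    proof (rule Suc.IH)
      show "inj_on v {..<n}"
        using Suc.prems(1) by (auto simp: inj_on_def v_def)
      show "degree ((T ^^ D) P j) < D" if "j < n" for j
        using deg[of D j] Suc.prems(2)[of j] that by auto
      show "\<exists>j<n. (T ^^ D) P j \<noteq> 0" using True nz by auto
      show "exp_poly n ((T ^^ D) P) v x = 0" if "x \<in> Z'" for x
        using Z'(2) that top[of D] by (simp add: exp_poly_def)
    qed (use Z' in auto)
    then show ?thesis using Z'(3) by simp
  qed
qed

subsection \<open>Upper bound for interpolation determinants\<close>

text \<open>The elements other than the maximum \<open>b\<close> all lie in \<open>{..<b}\<close>,
  so \<open>b\<close> is at least their number.\<close>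

lemma sum_lessThan_card_le:
  fixes A :: "nat set"
  assumes "finite A"
  shows "\<Sum>{..<card A} \<le> \<Sum>A"
  using assms
proof (induction A rule: finite_linorder_max_induct)
  case (insert b A)
  have "A \<subseteq> {..<b}" using insert.hyps(2) by auto
  then have "card A \<le> b" using card_mono[of "{..<b}" A] by simp
  moreover have "b \<notin> A" using insert.hyps(2) by auto
  ultimately show ?case using insert by simp
qed auto

lemma fdet_bound_rows:
  fixes M :: "nat \<Rightarrow> nat \<Rightarrow> real"
  assumes "\<And>i j. i < n \<Longrightarrow> j < n \<Longrightarrow> \<bar>M i j\<bar> \<le> B i"
  shows "\<bar>fdet n M\<bar> \<le> fact n * (\<Prod>i<n. B i)"
  using fdet_bound[of n "\<lambda>i j. M j i" B] assms unfolding fdet_transpose[of n M] by simp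

text \<open>Multilinearity in the rows: \<open>\<phi>\<close> picks one monomial from each row,
  which leaves a generalised Vandermonde determinant.\<close>

lemma fdet_polynomial_rows:
  fixes c :: "nat \<Rightarrow> nat \<Rightarrow> real"
  shows "fdet L (\<lambda>i j. \<Sum>n\<le>N. c i n * x j ^ n) =
    (\<Sum>\<phi>\<in>PiE {0..<L} (\<lambda>_. {..N}). (\<Prod>i = 0..<L. c i (\<phi> i)) * fdet L (\<lambda>i j. x j ^ \<phi> i))"
proof -
  have "fdet L (\<lambda>i j. \<Sum>n\<le>N. c i n * x j ^ n) =
    (\<Sum>p | p permutes {0..<L}. signof p *
      (\<Sum>\<phi>\<in>PiE {0..<L} (\<lambda>_. {..N}). \<Prod>i = 0..<L. c i (\<phi> i) * x (p i) ^ \<phi> i))"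
    unfolding fdet_leibniz by (subst prod_sum_PiE) auto
  also have "\<dots> = (\<Sum>\<phi>\<in>PiE {0..<L} (\<lambda>_. {..N}). \<Sum>p | p permutes {0..<L}. signof p *
      (\<Prod>i = 0..<L. c i (\<phi> i) * x (p i) ^ \<phi> i))"
    unfolding sum_distrib_left by (rule sum.swap)
  also have "\<dots> = (\<Sum>\<phi>\<in>PiE {0..<L} (\<lambda>_. {..N}).
      (\<Prod>i = 0..<L. c i (\<phi> i)) * fdet L (\<lambda>i j. x j ^ \<phi> i))"
    unfolding fdet_leibniz sum_distrib_left prod.distrib
    by (intro sum.cong refl) (simp add: algebra_simps)
  finally show ?thesis .
qed

text \<open>A generalised Vandermonde determinant vanishes unless its exponents are distinct, so only
  terms of degree at least \<open>0 + 1 + \<dots> + (L - 1)\<close> survive; this plays the part of the Schwarz lemma.\<close>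

lemma interpolation_fdet_bound_finite:
  fixes c :: "nat \<Rightarrow> nat \<Rightarrow> real"
  assumes x: "\<And>j. j < L \<Longrightarrow> \<bar>x j\<bar> \<le> \<rho>" and "0 < \<rho>" "1 \<le> E"
    and M: "\<And>i. i < L \<Longrightarrow> (\<Sum>n\<le>N. \<bar>c i n\<bar> * (E * \<rho>) ^ n) \<le> M i"
  shows "\<bar>fdet L (\<lambda>i j. \<Sum>n\<le>N. c i n * x j ^ n)\<bar> * E ^ \<Sum>{..<L} \<le> fact L * (\<Prod>i<L. M i)"
proof -
  define \<Phi> where "\<Phi> = PiE {0..<L} (\<lambda>_. {..N})"
  have term_le: "\<bar>(\<Prod>i = 0..<L. c i (\<phi> i)) * fdet L (\<lambda>i j. x j ^ \<phi> i)\<bar> * E ^ \<Sum>{..<L}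
      \<le> fact L * (\<Prod>i = 0..<L. \<bar>c i (\<phi> i)\<bar> * (E * \<rho>) ^ \<phi> i)" for \<phi>
  proof (cases "inj_on \<phi> {..<L}")
    case True
    \<comment> \<open>Since distinct exponents have a sum at least this large, the power of
      \<open>E\<close> on the left is absorbed by enlarging the radius from \<open>\<rho>\<close> to
      \<open>E * \<rho>\<close>.\<close>
    have "\<Sum>{..<L} \<le> \<Sum>(\<phi> ` {..<L})"
      using sum_lessThan_card_le[of "\<phi> ` {..<L}"] True by (simp add: card_image)
    also have "\<dots> = (\<Sum>i<L. \<phi> i)" using True by (simp add: sum.reindex)
    finally have "E ^ \<Sum>{..<L} \<le> E ^ (\<Sum>i<L. \<phi> i)" using \<open>1 \<le> E\<close> by (intro power_increasing)
    moreover have "\<bar>fdet L (\<lambda>i j. x j ^ \<phi> i)\<bar> \<le> fact L * (\<Prod>i<L. \<rho> ^ \<phi> i)"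
      by (rule fdet_bound_rows) (use x in \<open>auto simp: power_abs intro!: power_mono\<close>)
    ultimately have "\<bar>fdet L (\<lambda>i j. x j ^ \<phi> i)\<bar> * E ^ \<Sum>{..<L}
        \<le> (fact L * (\<Prod>i<L. \<rho> ^ \<phi> i)) * E ^ (\<Sum>i<L. \<phi> i)"
      using \<open>1 \<le> E\<close> \<open>0 < \<rho>\<close> by (intro mult_mono) (auto intro!: mult_nonneg_nonneg prod_nonneg)
    also have "\<dots> = fact L * (\<Prod>i = 0..<L. (E * \<rho>) ^ \<phi> i)"
      by (simp add: power_sum prod.distrib power_mult_distrib atLeast0LessThan)
    finally have "(\<Prod>i = 0..<L. \<bar>c i (\<phi> i)\<bar>) * (\<bar>fdet L (\<lambda>i j. x j ^ \<phi> i)\<bar> * E ^ \<Sum>{..<L})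
      \<le> (\<Prod>i = 0..<L. \<bar>c i (\<phi> i)\<bar>) * (fact L * (\<Prod>i = 0..<L. (E * \<rho>) ^ \<phi> i))"
      by (intro mult_left_mono) (auto intro: prod_nonneg)
    then show ?thesis by (simp add: abs_mult abs_prod prod.distrib algebra_simps)
  next
    case False
    then obtain i i' where "i < L" "i' < L" "i \<noteq> i'" "\<phi> i = \<phi> i'" by (auto simp: inj_on_def)
    then have "fdet L (\<lambda>i j. x j ^ \<phi> i) = 0"
      by (intro fdet_identical_rows[of i L i']) auto
    then show ?thesis
      using \<open>1 \<le> E\<close> \<open>0 < \<rho>\<close> by (auto intro!: mult_nonneg_nonneg prod_nonneg)
  qed
  have "\<bar>fdet L (\<lambda>i j. \<Sum>n\<le>N. c i n * x j ^ n)\<bar> * E ^ \<Sum>{..<L}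
      \<le> (\<Sum>\<phi>\<in>\<Phi>. \<bar>(\<Prod>i = 0..<L. c i (\<phi> i)) * fdet L (\<lambda>i j. x j ^ \<phi> i)\<bar>) * E ^ \<Sum>{..<L}"
    unfolding fdet_polynomial_rows \<Phi>_def using \<open>1 \<le> E\<close> by (intro mult_right_mono sum_abs) auto
  also have "\<dots> \<le> (\<Sum>\<phi>\<in>\<Phi>. fact L * (\<Prod>i = 0..<L. \<bar>c i (\<phi> i)\<bar> * (E * \<rho>) ^ \<phi> i))"
    unfolding sum_distrib_right by (intro sum_mono term_le)
  also have "\<dots> = fact L * (\<Prod>i = 0..<L. \<Sum>n\<le>N. \<bar>c i n\<bar> * (E * \<rho>) ^ n)"
    unfolding \<Phi>_def sum_distrib_left[symmetric] by (subst prod_sum_PiE) auto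
  also have "\<dots> \<le> fact L * (\<Prod>i = 0..<L. M i)"
    using M \<open>1 \<le> E\<close> \<open>0 < \<rho>\<close>
    by (intro mult_left_mono prod_mono) (auto intro!: sum_nonneg)
  finally show ?thesis by (simp add: atLeast0LessThan)
qed

text \<open>The bound for truncated series does not depend on the truncation, and the determinant is
  continuous in its entries, so the bound passes to the limit.\<close>

lemma interpolation_fdet_bound:
  fixes c :: "nat \<Rightarrow> nat \<Rightarrow> real"
  assumes x: "\<And>j. j < L \<Longrightarrow> \<bar>x j\<bar> \<le> \<rho>" and "0 < \<rho>" "1 \<le> E"
    and f: "\<And>i t. i < L \<Longrightarrow> (\<lambda>n. c i n * t ^ n) sums f i t"
    and M: "\<And>i. i < L \<Longrightarrow> (\<lambda>n. \<bar>c i n\<bar> * (E * \<rho>) ^ n) sums M i"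
  shows "\<bar>fdet L (\<lambda>i j. f i (x j))\<bar> * E ^ \<Sum>{..<L} \<le> fact L * (\<Prod>i<L. M i)"
proof (rule LIMSEQ_le_const2)
  have conv: "(\<lambda>N. \<Sum>n\<le>N. c i n * t ^ n) \<longlonglongrightarrow> f i t" if "i \<in> {0..<L}" for i t
    using f[of i t] that by (simp add: sums_def_le)
  have "(\<lambda>N. fdet L (\<lambda>i j. \<Sum>n\<le>N. c i n * x j ^ n)) \<longlonglongrightarrow> fdet L (\<lambda>i j. f i (x j))"
    unfolding fdet_leibniz
    by (rule tendsto_sum, rule tendsto_mult[OF tendsto_const], rule tendsto_prod, rule conv)
  then show "(\<lambda>N. \<bar>fdet L (\<lambda>i j. \<Sum>n\<le>N. c i n * x j ^ n)\<bar> * E ^ \<Sum>{..<L})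
      \<longlonglongrightarrow> \<bar>fdet L (\<lambda>i j. f i (x j))\<bar> * E ^ \<Sum>{..<L}"
    by (intro tendsto_mult tendsto_rabs tendsto_const)
  have "\<bar>fdet L (\<lambda>i j. \<Sum>n\<le>N. c i n * x j ^ n)\<bar> * E ^ \<Sum>{..<L} \<le> fact L * (\<Prod>i<L. M i)" for N
  proof (rule interpolation_fdet_bound_finite[OF x \<open>0 < \<rho>\<close> \<open>1 \<le> E\<close>])
    fix i assume "i < L"
    note sm = M[OF this]
    have "(\<Sum>n\<le>N. \<bar>c i n\<bar> * (E * \<rho>) ^ n) \<le> (\<Sum>n. \<bar>c i n\<bar> * (E * \<rho>) ^ n)"
      by (rule sum_le_suminf[OF sums_summable[OF sm] finite_atMost])
         (use \<open>1 \<le> E\<close> \<open>0 < \<rho>\<close> in simp)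
    then show "(\<Sum>n\<le>N. \<bar>c i n\<bar> * (E * \<rho>) ^ n) \<le> M i"
      using sums_unique[OF sm] by simp
  qed
  then show "\<exists>N. \<forall>n\<ge>N. \<bar>fdet L (\<lambda>i j. \<Sum>n'\<le>n. c i n' * x j ^ n')\<bar> * E ^ \<Sum>{..<L}
      \<le> fact L * (\<Prod>i<L. M i)" by blast
qed

text \<open>These are the Taylor coefficients at 0 of \<open>t ^ a * exp (w * t)\<close>.\<close>

definition monom_exp_coeff :: "nat \<Rightarrow> real \<Rightarrow> nat \<Rightarrow> real" where
  "monom_exp_coeff a w n = (if n < a then 0 else w ^ (n - a) / fact (n - a))"

lemma monom_exp_sums: "(\<lambda>n. monom_exp_coeff a w n * t ^ n) sums (t ^ a * exp (w * t))"
proof -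
  have "(\<lambda>n. (w * t) ^ n / fact n) sums exp (w * t)"
    using exp_converges[of "w * t"] by (simp add: divide_inverse mult.commute)
  then have "(\<lambda>n. t ^ a * ((w * t) ^ n / fact n)) sums (t ^ a * exp (w * t))"
    by (rule sums_mult)
  also have "(\<lambda>n. t ^ a * ((w * t) ^ n / fact n)) = (\<lambda>n. monom_exp_coeff a w (n + a) * t ^ (n + a))"
    by (auto simp: monom_exp_coeff_def power_add power_mult_distrib)
  finally show ?thesis
    using sums_iff_shift[of "\<lambda>n. monom_exp_coeff a w n * t ^ n" a "t ^ a * exp (w * t)"]
    by (simp add: monom_exp_coeff_def)
qed

text \<open>The majorant series is thus of the same kind, with frequency
  \<open>\<bar>w\<bar>\<close>, and has a closed form.\<close>

lemma abs_monom_exp_coeff: "\<bar>monom_exp_coeff a w n\<bar> = monom_exp_coeff a \<bar>w\<bar> n"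
  by (simp add: monom_exp_coeff_def power_abs)

subsection \<open>Liouville inequality\<close>

text \<open>\<open>H\<close> bounds the length, the sum of the absolute values of the coefficients,
  because it is subadditive and submultiplicative: products then cost no factor depending on the
  degree.\<close>

definition int_poly_value :: "real \<Rightarrow> nat \<Rightarrow> real \<Rightarrow> real \<Rightarrow> bool" where
  "int_poly_value \<beta> n H y \<longleftrightarrow> (\<exists>q :: nat \<Rightarrow> int.
     y = (\<Sum>s\<le>n. real_of_int (q s) * \<beta> ^ s) \<and> (\<Sum>s\<le>n. \<bar>real_of_int (q s)\<bar>) \<le> H)"

lemma int_poly_valueI:
  "y = (\<Sum>s\<le>n. real_of_int (q s) * \<beta> ^ s) \<Longrightarrow> (\<Sum>s\<le>n. \<bar>real_of_int (q s)\<bar>) \<le> H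
    \<Longrightarrow> int_poly_value \<beta> n H y"
  unfolding int_poly_value_def by blast

lemma int_poly_value_mono:
  assumes "int_poly_value \<beta> n H y" "n \<le> n'" "H \<le> H'"
  shows "int_poly_value \<beta> n' H' y"
proof -
  obtain q where q: "y = (\<Sum>s\<le>n. real_of_int (q s) * \<beta> ^ s)"
    "(\<Sum>s\<le>n. \<bar>real_of_int (q s)\<bar>) \<le> H"
    using assms(1) unfolding int_poly_value_def by blast
  define r where "r = (\<lambda>s. if s \<le> n then q s else 0)"
  have ext: "(\<Sum>s\<le>n'. h s (r s)) = (\<Sum>s\<le>n. h s (q s))"
    if "\<And>s. h s 0 = 0" for h :: "nat \<Rightarrow> int \<Rightarrow> real"
    using assms(2) that by (intro sum.mono_neutral_cong_right) (auto simp: r_def)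
  show ?thesis
    using q assms(3) ext[of "\<lambda>s z. real_of_int z * \<beta> ^ s"] ext[of "\<lambda>s z. \<bar>real_of_int z\<bar>"]
    by (intro int_poly_valueI[where q = r]) auto
qed

lemma int_poly_value_nonneg: "int_poly_value \<beta> n H y \<Longrightarrow> 0 \<le> H"
  unfolding int_poly_value_def by (meson abs_ge_zero order_trans sum_nonneg)

lemma int_poly_value_of_int: "int_poly_value \<beta> 0 \<bar>real_of_int z\<bar> (real_of_int z)"
  by (rule int_poly_valueI[where q = "\<lambda>_. z"]) auto

lemma int_poly_value_base: "int_poly_value \<beta> 1 1 \<beta>"
  by (rule int_poly_valueI[where q = "\<lambda>s. if s = 1 then 1 else 0"]) auto

lemma int_poly_value_add:
  assumes "int_poly_value \<beta> n H y" "int_poly_value \<beta> n H' y'"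
  shows "int_poly_value \<beta> n (H + H') (y + y')"
proof -
  obtain q q' where q: "y = (\<Sum>s\<le>n. real_of_int (q s) * \<beta> ^ s)"
      "(\<Sum>s\<le>n. \<bar>real_of_int (q s)\<bar>) \<le> H"
    and q': "y' = (\<Sum>s\<le>n. real_of_int (q' s) * \<beta> ^ s)"
      "(\<Sum>s\<le>n. \<bar>real_of_int (q' s)\<bar>) \<le> H'"
    using assms unfolding int_poly_value_def by blast
  have "(\<Sum>s\<le>n. \<bar>real_of_int (q s + q' s)\<bar>)
      \<le> (\<Sum>s\<le>n. \<bar>real_of_int (q s)\<bar> + \<bar>real_of_int (q' s)\<bar>)"
    by (intro sum_mono) auto
  then show ?thesis
    using q q' by (intro int_poly_valueI[where q = "\<lambda>s. q s + q' s"])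
      (auto simp: sum.distrib algebra_simps)
qed

text \<open>Cauchy product: \<open>F u\<close> collects the index pairs with sum \<open>u\<close>,
  and the triangle inequality within each group bounds the length.\<close>

lemma int_poly_value_mult:
  assumes "int_poly_value \<beta> n H y" "int_poly_value \<beta> n' H' y'"
  shows "int_poly_value \<beta> (n + n') (H * H') (y * y')"
proof -
  obtain q q' where q: "y = (\<Sum>s\<le>n. real_of_int (q s) * \<beta> ^ s)"
      "(\<Sum>s\<le>n. \<bar>real_of_int (q s)\<bar>) \<le> H"
    and q': "y' = (\<Sum>s\<le>n'. real_of_int (q' s) * \<beta> ^ s)"
      "(\<Sum>s\<le>n'. \<bar>real_of_int (q' s)\<bar>) \<le> H'"
    using assms unfolding int_poly_value_def by blast
  define S where "S = {..n} \<times> {..n'}"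
  define F where "F = (\<lambda>u. {p \<in> S. fst p + snd p = u})"
  define r where "r = (\<lambda>u. \<Sum>p\<in>F u. q (fst p) * q' (snd p))"
  have group: "(\<Sum>u\<le>n + n'. \<Sum>p\<in>F u. h p) = (\<Sum>p\<in>S. h p)" for h :: "nat \<times> nat \<Rightarrow> real"
    unfolding F_def by (rule sum.group) (auto simp: S_def)
  have "y * y' = (\<Sum>p\<in>S. (real_of_int (q (fst p)) * \<beta> ^ fst p) * (real_of_int (q' (snd p)) * \<beta> ^ snd p))"
    unfolding q q' S_def sum_product sum.cartesian_product by (simp add: case_prod_unfold)
  also have "\<dots> = (\<Sum>u\<le>n + n'. \<Sum>p\<in>F u. (real_of_int (q (fst p)) * \<beta> ^ fst p) * (real_of_int (q' (snd p)) * \<beta> ^ snd p))"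
    by (rule group[symmetric])
  also have "\<dots> = (\<Sum>u\<le>n + n'. real_of_int (r u) * \<beta> ^ u)"
    unfolding r_def of_int_sum sum_distrib_right
    by (intro sum.cong refl) (auto simp: F_def power_add)
  finally have 1: "y * y' = (\<Sum>u\<le>n + n'. real_of_int (r u) * \<beta> ^ u)" .
  have "(\<Sum>u\<le>n + n'. \<bar>real_of_int (r u)\<bar>)
      \<le> (\<Sum>u\<le>n + n'. \<Sum>p\<in>F u. \<bar>real_of_int (q (fst p))\<bar> * \<bar>real_of_int (q' (snd p))\<bar>)"
    unfolding r_def of_int_sum
    by (intro sum_mono order.trans[OF sum_abs]) (simp add: abs_mult)
  also have "\<dots> = (\<Sum>s\<le>n. \<bar>real_of_int (q s)\<bar>) * (\<Sum>s\<le>n'. \<bar>real_of_int (q' s)\<bar>)"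
    unfolding group S_def sum_product sum.cartesian_product by (simp add: case_prod_unfold)
  also have "\<dots> \<le> H * H'"
    using q(2) q'(2) by (intro mult_mono int_poly_value_nonneg[OF assms(1)]) (auto intro: sum_nonneg)
  finally show ?thesis using 1 by (intro int_poly_valueI[where q = r])
qed

lemma int_poly_value_power:
  assumes "int_poly_value \<beta> n H y"
  shows "int_poly_value \<beta> (m * n) (H ^ m) (y ^ m)"
proof (induction m)
  case 0
  then show ?case using int_poly_value_of_int[of \<beta> 1] by simp
next
  case (Suc m)
  then show ?case using int_poly_value_mult[OF assms Suc] by (simp add: algebra_simps)
qed

lemma int_poly_value_prod:
  assumes "finite I" "\<And>i. i \<in> I \<Longrightarrow> int_poly_value \<beta> n H (y i)"
  shows "int_poly_value \<beta> (card I * n) (H ^ card I) (\<Prod>i\<in>I. y i)"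
  using assms
proof (induction I rule: finite_induct)
  case empty
  then show ?case using int_poly_value_of_int[of \<beta> 1] by simp
next
  case (insert i I)
  then show ?case using int_poly_value_mult[of \<beta> n H "y i" "card I * n"] by simp
qed

lemma int_poly_value_sum:
  assumes "finite I" "\<And>i. i \<in> I \<Longrightarrow> int_poly_value \<beta> n H (y i)"
  shows "int_poly_value \<beta> n (real (card I) * H) (\<Sum>i\<in>I. y i)"
  using assms
proof (induction I rule: finite_induct)
  case empty
  then show ?case using int_poly_value_mono[OF int_poly_value_of_int[of \<beta> 0]] by simp
next
  case (insert i I)
  then show ?case
    using int_poly_value_add[of \<beta> n H "y i" "real (card I) * H" "sum y I"]
    by (simp add: distrib_right)
qed

lemma int_poly_value_fdet:
  assumes "\<And>i j. i < L \<Longrightarrow> j < L \<Longrightarrow> int_poly_value \<beta> n H (M i j)"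
  shows "int_poly_value \<beta> (L * n) (fact L * H ^ L) (fdet L M)"
proof -
  have "int_poly_value \<beta> (L * n) (H ^ L) (signof p * (\<Prod>i = 0..<L. M i (p i)))"
    if p: "p \<in> {p. p permutes {0..<L}}" for p
  proof -
    have "int_poly_value \<beta> n H (M i (p i))" if "i \<in> {0..<L}" for i
      using assms[of i "p i"] permutes_in_image[of p "{0..<L}" i] that p by simp
    from int_poly_value_prod[of "{0..<L}" \<beta> n H "\<lambda>i. M i (p i)", OF _ this]
    have "int_poly_value \<beta> (L * n) (H ^ L) (\<Prod>i = 0..<L. M i (p i))" by simp
    from int_poly_value_mult[OF int_poly_value_of_int[of \<beta> "sign p"] this]
    show ?thesis by (cases "evenperm p") (simp_all add: sign_def)
  qed
  from int_poly_value_sum[OF finite_permutations[of "{0..<L}"] this, simplified] show ?thesis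
    unfolding fdet_leibniz using card_permutations[of "{0..<L}" L] by simp
qed

text \<open>Writing \<open>d\<close> for the least degree of an integer polynomial vanishing at \<open>\<beta>\<close>, the scaled powers
  \<open>a ^ m * \<beta> ^ m\<close> lie in the lattice spanned by \<open>1, \<beta>, \<dots>, \<beta> ^ (d - 1)\<close>.\<close>

lemma algebraic_power_reduction:
  fixes \<beta> :: real
  assumes "algebraic \<beta>"
  obtains d :: nat and a :: int and C :: real where
    "0 < d" "a \<noteq> 0" "1 \<le> C" "\<bar>real_of_int a\<bar> \<le> C"
    "\<forall>u :: nat \<Rightarrow> int. (\<Sum>i<d. real_of_int (u i) * \<beta> ^ i) = 0 \<longrightarrow> (\<forall>i<d. u i = 0)"
    "\<forall>m. \<exists>e :: nat \<Rightarrow> int. (\<forall>i<d. \<bar>real_of_int (e i)\<bar> \<le> C ^ m) \<and>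
       real_of_int a ^ m * \<beta> ^ m = (\<Sum>i<d. real_of_int (e i) * \<beta> ^ i)"
proof -
  \<comment> \<open>\<open>R m\<close> says that \<open>\<beta>\<close> is a root of an integer
    polynomial of degree exactly \<open>m\<close>.\<close>
  define R where "R = (\<lambda>m. \<exists>c :: nat \<Rightarrow> int. c m \<noteq> 0 \<and> (\<Sum>i\<le>m. real_of_int (c i) * \<beta> ^ i) = 0)"
  obtain p where p: "\<And>i. coeff p i \<in> \<int>" "p \<noteq> 0" "poly p \<beta> = 0"
    using assms by (auto simp: algebraic_def)
  have "\<forall>i. \<exists>z. coeff p i = real_of_int z" using p(1) by (auto elim: Ints_cases)
  then obtain c :: "nat \<Rightarrow> int" where c: "\<And>i. coeff p i = real_of_int (c i)" by metis
  have "R (degree p)"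
    unfolding R_def using p c by (intro exI[of _ c]) (auto simp: poly_altdef, metis leading_coeff_0_iff of_int_0)
  define d where "d = (LEAST m. R m)"
  have "R d" unfolding d_def by (rule LeastI) fact
  then obtain c :: "nat \<Rightarrow> int" where c: "c d \<noteq> 0" "(\<Sum>i\<le>d. real_of_int (c i) * \<beta> ^ i) = 0"
    unfolding R_def by blast
  have "0 < d" using c by (cases d) auto
  have indep: "\<forall>i<d. u i = 0" if u: "(\<Sum>i<d. real_of_int (u i) * \<beta> ^ i) = 0" for u :: "nat \<Rightarrow> int"
  proof (rule ccontr)
    assume "\<not> (\<forall>i<d. u i = 0)"
    then have ne: "{i. i < d \<and> u i \<noteq> 0} \<noteq> {}" by auto
    \<comment> \<open>Truncating at the last nonzero coefficient gives a relation of exact degree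
      \<open>m < d\<close>, against the minimality of \<open>d\<close>.\<close>
    define m where "m = Max {i. i < d \<and> u i \<noteq> 0}"
    have "m \<in> {i. i < d \<and> u i \<noteq> 0}" unfolding m_def by (rule Max_in[OF _ ne]) simp
    then have m: "m < d" "u m \<noteq> 0" by auto
    have above: "u i = 0" if "i < d" "m < i" for i
      using Max_ge[of "{i. i < d \<and> u i \<noteq> 0}" i] that unfolding m_def by fastforce
    have "(\<Sum>i\<le>m. real_of_int (u i) * \<beta> ^ i) = (\<Sum>i<d. real_of_int (u i) * \<beta> ^ i)"
      by (rule sum.mono_neutral_left) (use m above in auto)
    then have "R m" using u m(2) unfolding R_def by metis
    then have "d \<le> m" unfolding d_def by (rule Least_le)
    with m(1) show False by simp
  qed
  define a where "a = c d"
  define B where "B = (\<Sum>i<d. \<bar>real_of_int (c i)\<bar>)"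
  \<comment> \<open>One reduction step multiplies the coefficient bound by at most \<open>C\<close>:
    the shift contributes \<open>\<bar>a\<bar>\<close>, the elimination of
    \<open>\<beta> ^ d\<close> contributes \<open>B\<close>.\<close>
  define C where "C = \<bar>real_of_int a\<bar> + B"
  have "0 \<le> B" by (simp add: B_def sum_nonneg)
  have a1: "1 \<le> \<bar>real_of_int a\<bar>" using c(1) unfolding a_def by linarith
  have rel: "real_of_int a * \<beta> ^ d = - (\<Sum>i<d. real_of_int (c i) * \<beta> ^ i)"
    using c(2) unfolding a_def lessThan_Suc_atMost[symmetric] by simp
  have red: "\<exists>e :: nat \<Rightarrow> int. (\<forall>i<d. \<bar>real_of_int (e i)\<bar> \<le> C ^ m) \<and>
       real_of_int a ^ m * \<beta> ^ m = (\<Sum>i<d. real_of_int (e i) * \<beta> ^ i)" for m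
  proof (induction m)
    case 0
    have "(\<Sum>i<d. real_of_int (if i = 0 then 1 else 0) * \<beta> ^ i) = 1"
      using \<open>0 < d\<close> by (simp add: if_distrib[of real_of_int] if_distrib[of "\<lambda>z. z * _"] cong: if_cong)
    then show ?case by (intro exI[of _ "\<lambda>i. if i = 0 then 1 else 0"]) auto
  next
    case (Suc m)
    then obtain e :: "nat \<Rightarrow> int" where e: "\<And>i. i < d \<Longrightarrow> \<bar>real_of_int (e i)\<bar> \<le> C ^ m"
      "real_of_int a ^ m * \<beta> ^ m = (\<Sum>i<d. real_of_int (e i) * \<beta> ^ i)" by auto
    obtain d' where d': "d = Suc d'" using \<open>0 < d\<close> by (cases d) auto
    \<comment> \<open>Multiplication by \<open>a * \<beta>\<close> shifts the coefficients and
      scales them by \<open>a\<close>; the overflow \<open>e d' * (a * \<beta> ^ d)\<close> is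
      rewritten by \<open>rel\<close>.\<close>
    define e' where "e' = (\<lambda>i. (if i = 0 then 0 else a * e (i - 1)) - e d' * c i)"
    have "real_of_int a ^ Suc m * \<beta> ^ Suc m = (\<Sum>i<d. real_of_int (e i) * \<beta> ^ i) * (real_of_int a * \<beta>)"
      unfolding e(2)[symmetric] by simp
    also have "\<dots> = (\<Sum>i<d'. real_of_int (a * e i) * \<beta> ^ Suc i) + real_of_int (e d') * (real_of_int a * \<beta> ^ d)"
      unfolding d' by (simp add: sum_distrib_right sum_distrib_left algebra_simps)
    also have "(\<Sum>i<d'. real_of_int (a * e i) * \<beta> ^ Suc i)
        = (\<Sum>i<d. real_of_int (if i = 0 then 0 else a * e (i - 1)) * \<beta> ^ i)"
      unfolding d' sum.lessThan_Suc_shift by simp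
    also have "\<dots> + real_of_int (e d') * (real_of_int a * \<beta> ^ d) = (\<Sum>i<d. real_of_int (e' i) * \<beta> ^ i)"
      unfolding rel e'_def by (simp add: sum_distrib_left sum_subtractf[symmetric] algebra_simps)
    finally have 1: "real_of_int a ^ Suc m * \<beta> ^ Suc m = (\<Sum>i<d. real_of_int (e' i) * \<beta> ^ i)" .
    have "\<bar>real_of_int (e' i)\<bar> \<le> C ^ Suc m" if "i < d" for i
    proof -
      have "0 \<le> C ^ m" using \<open>0 \<le> B\<close> by (simp add: C_def)
      have ci: "\<bar>real_of_int (c i)\<bar> \<le> B"
        unfolding B_def using that by (intro member_le_sum) auto
      have "\<bar>real_of_int (e' i)\<bar> \<le> \<bar>real_of_int (if i = 0 then 0 else a * e (i - 1))\<bar> + \<bar>real_of_int (e d' * c i)\<bar>"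
        unfolding e'_def of_int_diff by (rule abs_triangle_ineq4)
      also have "\<dots> \<le> \<bar>real_of_int a\<bar> * C ^ m + C ^ m * B"
        using e(1)[of "i - 1"] e(1)[of d'] ci that \<open>0 \<le> C ^ m\<close> d'
        by (intro add_mono) (auto simp: abs_mult intro!: mult_mono)
      also have "\<dots> = C ^ Suc m"
        by (simp only: power_Suc C_def[symmetric] distrib_right[symmetric] mult.commute[of "C ^ m" B])
      finally show ?thesis .
    qed
    with 1 show ?case by blast
  qed
  have "1 \<le> C" "\<bar>real_of_int a\<bar> \<le> C" using a1 \<open>0 \<le> B\<close> by (auto simp: C_def)
  moreover have "a \<noteq> 0" using c(1) by (simp add: a_def)
  ultimately show ?thesis using that[of d a C] \<open>0 < d\<close> indep red by blast
qed

text \<open>A Liouville inequality: multiplication by the given value acts on the lattice of the previous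
  lemma by an integer matrix, whose determinant is a nonzero integer.\<close>

lemma algebraic_liouville:
  fixes \<beta> :: real
  assumes "algebraic \<beta>"
  obtains d :: nat and K :: real where "1 \<le> K"
    "\<And>n H y. int_poly_value \<beta> n H y \<Longrightarrow> y \<noteq> 0 \<Longrightarrow> 1 \<le> \<bar>y\<bar> * K ^ Suc n * H ^ d"
proof -
  obtain d a C where d: "0 < d" and a: "a \<noteq> 0" and C: "1 \<le> C" "\<bar>real_of_int a\<bar> \<le> C"
    and indep: "\<forall>u :: nat \<Rightarrow> int. (\<Sum>i<d. real_of_int (u i) * \<beta> ^ i) = 0 \<longrightarrow> (\<forall>i<d. u i = 0)"
    and red: "\<forall>m. \<exists>e :: nat \<Rightarrow> int. (\<forall>i<d. \<bar>real_of_int (e i)\<bar> \<le> C ^ m) \<and>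
       real_of_int a ^ m * \<beta> ^ m = (\<Sum>i<d. real_of_int (e i) * \<beta> ^ i)"
    by (rule algebraic_power_reduction[OF assms])
  from choice[OF red] obtain e :: "nat \<Rightarrow> nat \<Rightarrow> int"
    where e: "\<And>m i. i < d \<Longrightarrow> \<bar>real_of_int (e m i)\<bar> \<le> C ^ m"
      "\<And>m. real_of_int a ^ m * \<beta> ^ m = (\<Sum>i<d. real_of_int (e m i) * \<beta> ^ i)" by blast
  define V where "V = (\<Sum>i<d. \<bar>\<beta>\<bar> ^ i)"
  have V: "\<bar>\<beta> ^ i\<bar> \<le> V" if "i < d" for i
    unfolding V_def power_abs using that by (intro member_le_sum) auto
  have "1 \<le> V" using V[OF d] by simp
  \<comment> \<open>\<open>K\<close> gathers the \<open>fact d\<close> Leibniz terms, the bound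
    \<open>V\<close> on the special column and the powers of \<open>C\<close>; its exponent suffices
    because \<open>(n + d) * d \<le> d * (d + 1) * Suc n\<close>.\<close>
  define K where "K = fact d * V * C ^ (d * (d + 1))"
  have f1: "(1 :: real) \<le> fact d" by (rule fact_ge_1)
  have "1 \<le> K" unfolding K_def using f1 \<open>1 \<le> V\<close> C(1)
    by (intro mult_ge1_I one_le_power) auto
  have main: "1 \<le> \<bar>y\<bar> * K ^ Suc n * H ^ d" if y: "int_poly_value \<beta> n H y" "y \<noteq> 0" for n H y
  proof -
    obtain q where q: "y = (\<Sum>s\<le>n. real_of_int (q s) * \<beta> ^ s)"
      "(\<Sum>s\<le>n. \<bar>real_of_int (q s)\<bar>) \<le> H"
      using y(1) unfolding int_poly_value_def by blast
    \<comment> \<open>\<open>a ^ N\<close> clears the denominators of all powers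
      \<open>\<beta> ^ (s + l)\<close> with \<open>s \<le> n\<close> and
      \<open>l < d\<close>.\<close>
    define N where "N = n + d"
    define \<xi> where "\<xi> = real_of_int a ^ N * y"
    \<comment> \<open>Row \<open>l\<close> expresses \<open>\<xi> * \<beta> ^ l\<close> in the
      powers of \<open>\<beta>\<close> below \<open>d\<close>, so these powers form an eigenvector
      of \<open>M\<close> with eigenvalue \<open>\<xi>\<close>.\<close>
    define M where "M = (\<lambda>l i. \<Sum>s\<le>n. q s * a ^ (N - (s + l)) * e (s + l) i)"
    define B where "B = H * C ^ N"
    have "0 \<le> H" by (rule int_poly_value_nonneg[OF y(1)])
    have B: "\<bar>real_of_int (M l i)\<bar> \<le> B" if "l < d" "i < d" for l i
    proof -
      have "\<bar>real_of_int (M l i)\<bar> \<le> (\<Sum>s\<le>n. \<bar>real_of_int (q s)\<bar> * C ^ N)"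
        unfolding M_def of_int_sum
      proof (intro order.trans[OF sum_abs] sum_mono)
        fix s assume "s \<in> {..n}"
        then have N: "N = (N - (s + l)) + (s + l)" using that by (simp add: N_def)
        have "\<bar>real_of_int a\<bar> ^ (N - (s + l)) * \<bar>real_of_int (e (s + l) i)\<bar>
            \<le> C ^ (N - (s + l)) * C ^ (s + l)"
          using C e(1)[OF that(2)] by (intro mult_mono power_mono) auto
        also have "\<dots> = C ^ N" by (subst N) (simp only: power_add)
        finally have "\<bar>real_of_int (q s)\<bar> * (\<bar>real_of_int a\<bar> ^ (N - (s + l)) * \<bar>real_of_int (e (s + l) i)\<bar>)
            \<le> \<bar>real_of_int (q s)\<bar> * C ^ N" by (rule mult_left_mono) auto
        then show "\<bar>real_of_int (q s * a ^ (N - (s + l)) * e (s + l) i)\<bar> \<le> \<bar>real_of_int (q s)\<bar> * C ^ N"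
          by (simp add: abs_mult power_abs mult.assoc)
      qed
      also have "\<dots> \<le> B"
        unfolding B_def sum_distrib_right[symmetric] using q(2) C(1) by (intro mult_right_mono) auto
      finally show ?thesis .
    qed
    have ev: "(\<Sum>i<d. real_of_int (M l i) * \<beta> ^ i) = \<xi> * \<beta> ^ l" if "l < d" for l
    proof -
      have "(\<Sum>i<d. real_of_int (M l i) * \<beta> ^ i) = (\<Sum>s\<le>n. real_of_int (q s) * real_of_int a ^ (N - (s + l))
          * (\<Sum>i<d. real_of_int (e (s + l) i) * \<beta> ^ i))"
        unfolding M_def of_int_sum sum_distrib_right sum_distrib_left
        by (subst sum.swap) (simp add: mult.assoc)
      also have "\<dots> = (\<Sum>s\<le>n. real_of_int a ^ N * (real_of_int (q s) * \<beta> ^ s) * \<beta> ^ l)"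
      proof (intro sum.cong refl)
        fix s assume "s \<in> {..n}"
        then have N: "N = (N - (s + l)) + (s + l)" using that by (simp add: N_def)
        show "real_of_int (q s) * real_of_int a ^ (N - (s + l)) * (\<Sum>i<d. real_of_int (e (s + l) i) * \<beta> ^ i)
          = real_of_int a ^ N * (real_of_int (q s) * \<beta> ^ s) * \<beta> ^ l"
          unfolding e(2)[symmetric] by (subst (2) N) (simp add: power_add algebra_simps)
      qed
      also have "\<dots> = \<xi> * \<beta> ^ l"
        unfolding \<xi>_def q(1) by (simp add: sum_distrib_left sum_distrib_right)
      finally show ?thesis .
    qed
    have "\<xi> \<noteq> 0" using a y(2) by (simp add: \<xi>_def)
    \<comment> \<open>A vector in the left kernel, paired with the powers of \<open>\<beta>\<close>,
      would give a nontrivial integer relation of degree below \<open>d\<close>.\<close>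
    have nz: "fdet d M \<noteq> 0"
    proof
      assume "fdet d M = 0"
      then have "fdet d (\<lambda>i j. M j i) = 0" unfolding fdet_transpose[of d M] .
      from fdet_eq_0_imp_right_kernel[OF this]
      obtain u where u: "\<exists>j<d. u j \<noteq> 0" "\<And>i. i < d \<Longrightarrow> (\<Sum>l<d. M l i * u l) = 0" by blast
      have "\<xi> * (\<Sum>l<d. real_of_int (u l) * \<beta> ^ l) = (\<Sum>l<d. real_of_int (u l) * (\<Sum>i<d. real_of_int (M l i) * \<beta> ^ i))"
        unfolding sum_distrib_left by (intro sum.cong refl) (simp add: ev sum_distrib_left[symmetric])
      also have "\<dots> = (\<Sum>i<d. real_of_int (\<Sum>l<d. M l i * u l) * \<beta> ^ i)"
        unfolding sum_distrib_left of_int_sum sum_distrib_right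
        by (subst sum.swap) (simp add: algebra_simps)
      also have "\<dots> = 0" using u(2) by simp
      finally have "(\<Sum>l<d. real_of_int (u l) * \<beta> ^ l) = 0" using \<open>\<xi> \<noteq> 0\<close> by simp
      from indep this u(1) show False by auto
    qed
    obtain d' where d': "d = Suc d'" using d by (cases d) auto
    have "1 \<le> \<bar>real_of_int (fdet d M)\<bar>" using nz by linarith
    \<comment> \<open>The eigenvector has entry \<open>\<beta> ^ 0 = 1\<close> at index 0, so the
      determinant is unchanged while its first column acquires the factor
      \<open>\<xi>\<close>.\<close>
    also have "real_of_int (fdet d M) = fdet d (\<lambda>i j. if j = 0 then \<xi> * \<beta> ^ i else real_of_int (M i j))"
      using fdet_eigenvector[OF d, of "\<lambda>i j. real_of_int (M i j)" "\<lambda>i. \<beta> ^ i" \<xi>] ev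
      by (simp add: fdet_of_int)
    also have "\<bar>\<dots>\<bar> \<le> fact d * (\<Prod>j<d. if j = 0 then \<bar>\<xi>\<bar> * V else B)"
      using V B by (intro fdet_bound) (auto simp: abs_mult intro!: mult_left_mono)
    also have "(\<Prod>j<d. if j = 0 then \<bar>\<xi>\<bar> * V else B) = \<bar>\<xi>\<bar> * V * B ^ d'"
      unfolding d' prod.lessThan_Suc_shift by simp
    finally have 1: "1 \<le> fact d * (\<bar>\<xi>\<bar> * V * B ^ d')" .
    \<comment> \<open>A nonzero value has a nonzero integer coefficient. The bound permits replacing
      the exponent \<open>d' = d - 1\<close> of \<open>H\<close> by \<open>d\<close>.\<close>
    have "1 \<le> H"
    proof -
      obtain s where s: "s \<le> n" "q s \<noteq> 0"
        using y(2) unfolding q(1) by (metis (no_types, lifting) atMost_iff mult_zero_left of_int_0 sum.neutral)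
      have "1 \<le> \<bar>real_of_int (q s)\<bar>" using s(2) by linarith
      also have "\<dots> \<le> (\<Sum>s\<le>n. \<bar>real_of_int (q s)\<bar>)" using s(1) by (intro member_le_sum) auto
      finally show ?thesis using q(2) by simp
    qed
    have "fact d * (\<bar>\<xi>\<bar> * V * B ^ d') \<le> fact d * ((C ^ N * \<bar>y\<bar>) * V * B ^ d')"
      using C \<open>1 \<le> V\<close> \<open>0 \<le> H\<close> unfolding \<xi>_def B_def
      by (intro mult_left_mono mult_right_mono) (auto simp: abs_mult power_abs intro!: power_mono mult_right_mono)
    also have "\<dots> = \<bar>y\<bar> * (fact d * V) * C ^ (N * d) * H ^ d'"
      unfolding B_def d' by (simp add: power_mult_distrib power_add power_mult algebra_simps)
    also have "\<dots> \<le> \<bar>y\<bar> * (fact d * V) ^ Suc n * (C ^ (d * (d + 1))) ^ Suc n * H ^ d"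
    proof (intro mult_mono)
      have "1 \<le> fact d * V" using f1 \<open>1 \<le> V\<close> by (intro mult_ge1_I) auto
      then show "fact d * V \<le> (fact d * V) ^ Suc n"
        using power_increasing[of 1 "Suc n" "fact d * V"] by simp
      have "N \<le> (d + 1) * Suc n" unfolding N_def by simp
      then have "N * d \<le> d * (d + 1) * Suc n" by (metis mult.assoc mult.commute mult_le_mono1)
      then show "C ^ (N * d) \<le> (C ^ (d * (d + 1))) ^ Suc n"
        unfolding power_mult[symmetric] using C(1) by (intro power_increasing)
      show "H ^ d' \<le> H ^ d" using \<open>1 \<le> H\<close> d' by (intro power_increasing) auto
    qed (use C \<open>1 \<le> V\<close> \<open>1 \<le> H\<close> in auto)
    also have "\<dots> = \<bar>y\<bar> * K ^ Suc n * H ^ d"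
      unfolding K_def by (simp only: power_mult_distrib mult.assoc)
    finally show ?thesis using 1 by linarith
  qed
  show ?thesis using that[OF \<open>1 \<le> K\<close> main] by blast
qed

subsection \<open>A special case of the Gelfond--Schneider theorem\<close>

lemma fdet_scale: "fdet n (\<lambda>i j. c * M i j) = c ^ n * fdet n M"
  unfolding fdet_leibniz by (simp add: prod.distrib sum_distrib_left algebra_simps)

text \<open>A vanishing determinant gives a nontrivial combination of the functions that is zero at
  \<open>D1 * D0\<close> points, more than an exponential polynomial with \<open>D1\<close>
  frequencies and degrees below \<open>D0\<close> allows. The row index \<open>i\<close> encodes the
  frequency \<open>i div D0\<close> and the power \<open>i mod D0\<close>.\<close>

lemma fdet_exp_monomials_neq_0:
  fixes x w :: "nat \<Rightarrow> real"
  assumes "inj_on x {..<D1 * D0}" "inj_on w {..<D1}"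
  shows "fdet (D1 * D0) (\<lambda>i j. x j ^ (i mod D0) * exp (w (i div D0) * x j)) \<noteq> 0"
proof
  let ?L = "D1 * D0"
  assume "fdet ?L (\<lambda>i j. x j ^ (i mod D0) * exp (w (i div D0) * x j)) = 0"
  then have "fdet ?L (\<lambda>j i. x j ^ (i mod D0) * exp (w (i div D0) * x j)) = 0"
    using fdet_transpose[of ?L "\<lambda>i j. x j ^ (i mod D0) * exp (w (i div D0) * x j)"] by simp
  from fdet_eq_0_imp_right_kernel[OF this] obtain u l where u: "l < ?L" "u l \<noteq> 0"
    "\<And>j. j < ?L \<Longrightarrow> (\<Sum>i<?L. x j ^ (i mod D0) * exp (w (i div D0) * x j) * u i) = 0" by blast
  have "0 < D0" using u(1) by (cases D0) auto
  define P where "P = (\<lambda>b. \<Sum>a<D0. Polynomial.monom (u (b * D0 + a)) a)"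
  have Pcoeff: "coeff (P b) a = (if a < D0 then u (b * D0 + a) else 0)" for a b
    by (simp add: P_def coeff_sum)
  have "exp_poly D1 P w y = (\<Sum>i<?L. y ^ (i mod D0) * exp (w (i div D0) * y) * u i)" for y
  proof -
    have "(\<Sum>i<?L. y ^ (i mod D0) * exp (w (i div D0) * y) * u i)
      = (\<Sum>b<D1. \<Sum>i = b * D0..<b * D0 + D0. y ^ (i mod D0) * exp (w (i div D0) * y) * u i)"
      by (rule sum.nat_group[symmetric])
    also have "\<dots> = (\<Sum>b<D1. \<Sum>a<D0. y ^ a * exp (w b * y) * u (b * D0 + a))"
    proof (rule sum.cong[OF refl])
      fix b
      have "(\<Sum>i = b * D0..<b * D0 + D0. y ^ (i mod D0) * exp (w (i div D0) * y) * u i)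
        = (\<Sum>a = 0..<D0. y ^ ((a + b * D0) mod D0) * exp (w ((a + b * D0) div D0) * y) * u (a + b * D0))"
        using sum.shift_bounds_nat_ivl[of "\<lambda>i. y ^ (i mod D0) * exp (w (i div D0) * y) * u i" 0 "b * D0" D0]
        by (simp add: add.commute)
      also have "\<dots> = (\<Sum>a<D0. y ^ a * exp (w b * y) * u (b * D0 + a))"
        unfolding atLeast0LessThan by (intro sum.cong refl) (simp add: add.commute)
      finally show "(\<Sum>i = b * D0..<b * D0 + D0. y ^ (i mod D0) * exp (w (i div D0) * y) * u i)
        = (\<Sum>a<D0. y ^ a * exp (w b * y) * u (b * D0 + a))" .
    qed
    also have "\<dots> = exp_poly D1 P w y"
      unfolding exp_poly_def P_def poly_sum poly_monom sum_distrib_right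
      by (intro sum.cong refl) (simp add: algebra_simps)
    finally show ?thesis by simp
  qed
  then have zero: "exp_poly D1 P w y = 0" if "y \<in> x ` {..<?L}" for y
    using u(3) that by auto
  have deg: "degree (P b) < D0" for b
    using \<open>0 < D0\<close> degree_le[of "D0 - 1" "P b"] by (force simp: Pcoeff)
  have "coeff (P (l div D0)) (l mod D0) \<noteq> 0" using u(2) \<open>0 < D0\<close> by (simp add: Pcoeff)
  moreover have "l div D0 < D1" using u(1) by (simp add: less_mult_imp_div_less)
  ultimately have nz: "\<exists>b<D1. P b \<noteq> 0" by (metis coeff_0)
  have "card (x ` {..<?L}) < D1 * D0"
    by (rule card_zeros_exp_poly[OF assms(2) deg nz _ zero]) auto
  then show False using assms(1) by (simp add: card_image)
qed

lemma power_mult_pow2_unbounded: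
  fixes Q :: real
  shows "\<exists>N\<ge>1. Q * real N ^ m < 2 ^ (N - 1)"
proof -
  have "((\<lambda>x :: real. x ^ m / exp x) \<longlongrightarrow> 0) at_top" by (rule tendsto_power_div_exp_0)
  moreover have "filterlim (\<lambda>N. ln 2 * real N) at_top sequentially"
    by (intro filterlim_tendsto_pos_mult_at_top[OF tendsto_const] filterlim_real_sequentially) simp
  ultimately have "(\<lambda>N. (ln 2 * real N) ^ m / exp (ln 2 * real N)) \<longlonglongrightarrow> 0"
    by (rule filterlim_compose)
  from tendsto_mult[OF tendsto_const this, of "2 * \<bar>Q\<bar> / ln 2 ^ m"]
  have "(\<lambda>N. (2 * \<bar>Q\<bar> / ln 2 ^ m) * ((ln 2 * real N) ^ m / exp (ln 2 * real N))) \<longlonglongrightarrow> 0"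
    by (simp only: mult_zero_right)
  then have "eventually (\<lambda>N. (2 * \<bar>Q\<bar> / ln 2 ^ m) * ((ln 2 * real N) ^ m / exp (ln 2 * real N)) < 1) sequentially"
    by (rule order_tendstoD(2)) simp
  with eventually_ge_at_top[of 1]
  have "eventually (\<lambda>N. N \<ge> 1 \<and> (2 * \<bar>Q\<bar> / ln 2 ^ m) * ((ln 2 * real N) ^ m / exp (ln 2 * real N)) < 1) sequentially"
    by (rule eventually_conj)
  then obtain N where N: "N \<ge> 1" "(2 * \<bar>Q\<bar> / ln 2 ^ m) * ((ln 2 * real N) ^ m / exp (ln 2 * real N)) < 1"
    using eventually_happens sequentially_bot by blast
  have e: "exp (ln 2 * real N) = (2 :: real) ^ N"
    by (metis exp_ln exp_of_nat_mult mult.commute zero_less_numeral)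
  have "2 * \<bar>Q\<bar> * real N ^ m < 2 ^ N"
    using N(2) unfolding e by (simp add: field_simps power_mult_distrib)
  moreover have "(2 :: real) ^ N = 2 * 2 ^ (N - 1)" using N(1) by (cases N) auto
  moreover have "Q * real N ^ m \<le> \<bar>Q\<bar> * real N ^ m" by (intro mult_right_mono) auto
  ultimately have "Q * real N ^ m < 2 ^ (N - 1)" by linarith
  then show ?thesis using N(1) by blast
qed


text \<open>Equality would turn every entry of the interpolation determinant into an integer
  polynomial in \<open>\<beta>\<close> over a power of \<open>q\<close>. The upper and lower bounds
  together then keep \<open>2 ^ (N - 1)\<close> below a fixed polynomial in \<open>N\<close> for
  every \<open>N \<ge> 1\<close>.\<close>

lemma rational_powr_neq_power:
  fixes r \<beta> :: real
  assumes "r \<in> \<rat>" "0 < r" "r \<noteq> 1" "algebraic \<beta>" "\<beta> \<notin> \<rat>"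
  shows "r powr \<beta> \<noteq> \<beta> ^ k"
proof
  assume rel: "r powr \<beta> = \<beta> ^ k"
  obtain p q :: nat where pq: "q \<noteq> 0" "\<bar>r\<bar> = real p / real q"
    using Rats_abs_nat_div_natE[OF assms(1)] by metis
  then have r: "r = real p / real q" and "p \<ge> 1" "q \<ge> 1"
    using assms(2) by (cases p; auto)+
  obtain d K where K: "1 \<le> K"
    and liouville: "\<And>n H y. int_poly_value \<beta> n H y \<Longrightarrow> y \<noteq> 0 \<Longrightarrow> 1 \<le> \<bar>y\<bar> * K ^ Suc n * H ^ d"
    using algebraic_liouville[OF assms(4)] by metis
  define c where "c = 1 + \<bar>\<beta>\<bar>"
  define W where "W = exp (4 * c * \<bar>ln r\<bar>)"
  have "1 \<le> c" "1 \<le> W" by (auto simp: c_def W_def)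
  define Q where "Q = 4 * c * W * real q * K ^ (2 + k) * (2 * real p * real q) ^ d"
  have "2 ^ (N - 1) \<le> Q * real N ^ (6 + 6 * d)" if N: "N \<ge> 1" for N
  proof -
    \<comment> \<open>\<open>N\<close> frequencies and \<open>D\<close> powers face a grid of
      \<open>S * S\<close> points. There are as many functions as points,
      \<open>L = N * D = S * S\<close>, and \<open>N * S = D\<close> keeps the exponents
      \<open>b * m\<close> and \<open>b * n\<close> at most \<open>D\<close>.\<close>
    define S where "S = N ^ 2"
    define D where "D = N ^ 3"
    define L where "L = N * D"
    have L_S: "L = S * S" by (simp add: L_def D_def S_def power2_eq_square power3_eq_cube)
    have N_S: "N * S = D" by (simp add: D_def S_def power2_eq_square power3_eq_cube)
    have pos: "1 \<le> S" "1 \<le> D" "1 \<le> L" using N by (auto simp: S_def D_def L_def)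
    define x where "x = (\<lambda>j. real (j mod S) + real (j div S) * \<beta>)"
    define f where "f = (\<lambda>i t. t ^ (i mod D) * exp (real (i div D) * ln r * t))"
    define \<Delta> where "\<Delta> = fdet L (\<lambda>i j. f i (x j))"
    have idx: "i div D < N" "i mod D < D" "i div S < S" "i mod S < S" if "i < L" for i
      using that pos by (auto simp: L_def less_mult_imp_div_less L_S)
         (use that in \<open>auto simp: L_S less_mult_imp_div_less\<close>)
    have "inj_on x {..<L}"
    proof (rule inj_onI)
      fix j j' assume eq: "x j = x j'"
      have "real (j div S) = real (j' div S)"
      proof (rule ccontr)
        assume ne: "real (j div S) \<noteq> real (j' div S)"
        then have "\<beta> = (real (j' mod S) - real (j mod S)) / (real (j div S) - real (j' div S))"
          using eq by (simp add: x_def field_simps)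
        also have "\<dots> \<in> \<rat>" by simp
        finally show False using assms(5) by simp
      qed
      moreover from this have "j mod S = j' mod S" using eq by (simp add: x_def)
      ultimately show "j = j'" by (metis div_mult_mod_eq of_nat_eq_iff)
    qed
    moreover have "inj_on (\<lambda>b. real b * ln r) {..<N}"
      using assms(2,3) by (auto simp: inj_on_def)
    ultimately have "\<Delta> \<noteq> 0"
      unfolding \<Delta>_def f_def L_def by (rule fdet_exp_monomials_neq_0)
    \<comment> \<open>The factor \<open>q ^ D\<close> clears the denominator of
      \<open>r ^ (b * m)\<close> in each entry, as \<open>b * m \<le> D\<close>.\<close>
    define \<Delta>' where "\<Delta>' = fdet L (\<lambda>i j. real q ^ D * f i (x j))"
    have \<Delta>': "\<Delta>' = (real q ^ D) ^ L * \<Delta>" unfolding \<Delta>'_def \<Delta>_def by (rule fdet_scale)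
    define H where "H = (real (2 * S * p * q)) ^ D"
    have entry: "int_poly_value \<beta> ((1 + k) * D) H (real q ^ D * f i (x j))" if ij: "i < L" "j < L" for i j
    proof -
      define a b m n where "a = i mod D" and "b = i div D" and "m = j mod S" and "n = j div S"
      note bounds = idx(1,2)[OF ij(1), folded a_def b_def] idx(3,4)[OF ij(2), folded m_def n_def]
      have bm: "b * m \<le> D" and bn: "b * n \<le> D"
        unfolding N_S[symmetric] using bounds by (auto intro: mult_le_mono)
      have "exp (real b * ln r * x j) = (r powr (real m) * (r powr \<beta>) powr (real n)) powr (real b)"
        using assms(2) by (simp add: x_def m_def n_def powr_def exp_add[symmetric] ln_mult algebra_simps)
      \<comment> \<open>Here the assumed relation enters: \<open>r powr \<beta>\<close> becomes
        \<open>\<beta> ^ k\<close>.\<close>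
      also have "\<dots> = (r ^ m * (\<beta> ^ k) ^ n) ^ b"
        using assms(2) rel[symmetric] by (simp add: powr_realpow)
      finally have ex: "exp (real b * ln r * x j) = r ^ (b * m) * \<beta> ^ (k * (b * n))"
        by (simp add: power_mult_distrib power_mult[symmetric] mult_ac)
      have "real q ^ D * r ^ (b * m) = real_of_int (int (q ^ (D - b * m) * p ^ (b * m)))"
        using bm pq(1) power_add[of "real q" "D - b * m" "b * m"]
        by (simp add: r power_divide)
      then have "real q ^ D * f i (x j)
        = (x j ^ a * real_of_int (int (q ^ (D - b * m) * p ^ (b * m)))) * \<beta> ^ (k * (b * n))"
        unfolding f_def a_def[symmetric] b_def[symmetric] ex by (simp add: algebra_simps)
      moreover have "int_poly_value \<beta> 1 (2 * real S) (x j)"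
      proof -
        have 1: "int_poly_value \<beta> 1 (real S) (real m)"
          using int_poly_value_mono[OF int_poly_value_of_int[of \<beta> "int m"], of 1 "real S"] bounds by simp
        have "int_poly_value \<beta> 1 (real n) (real n * \<beta>)"
          using int_poly_value_mult[OF int_poly_value_of_int[of \<beta> "int n"] int_poly_value_base[of \<beta>]] by simp
        then have "int_poly_value \<beta> 1 (real S) (real n * \<beta>)"
          by (rule int_poly_value_mono) (use bounds in auto)
        from int_poly_value_add[OF 1 this] show ?thesis by (simp add: x_def m_def n_def)
      qed
      then have "int_poly_value \<beta> D ((2 * real S) ^ D) (x j ^ a)"
      proof (rule int_poly_value_mono[OF int_poly_value_power])
        show "(2 * real S) ^ a \<le> (2 * real S) ^ D" using bounds pos by (intro power_increasing) auto
      qed (use bounds in simp)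
      moreover have "int_poly_value \<beta> 0 ((real p * real q) ^ D) (real_of_int (int (q ^ (D - b * m) * p ^ (b * m))))"
      proof (rule int_poly_value_mono[OF int_poly_value_of_int])
        have "real q ^ (D - b * m) * real p ^ (b * m) \<le> real q ^ D * real p ^ D"
          using \<open>p \<ge> 1\<close> \<open>q \<ge> 1\<close> bm by (intro mult_mono power_increasing) auto
        then show "\<bar>real_of_int (int (q ^ (D - b * m) * p ^ (b * m)))\<bar> \<le> (real p * real q) ^ D"
          by (simp add: power_mult_distrib mult.commute)
      qed simp
      moreover have "int_poly_value \<beta> (k * D) 1 (\<beta> ^ (k * (b * n)))"
        using bn by (intro int_poly_value_mono[OF int_poly_value_power[OF int_poly_value_base]]) auto
      ultimately have "int_poly_value \<beta> ((D + 0) + k * D) (((2 * real S) ^ D * (real p * real q) ^ D) * 1) (real q ^ D * f i (x j))"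
        using int_poly_value_mult by metis
      then show ?thesis by (simp add: H_def power_mult_distrib mult_ac)
    qed
    have "\<Delta>' \<noteq> 0" using \<open>\<Delta> \<noteq> 0\<close> pq(1) by (simp add: \<Delta>')
    have lower: "1 \<le> \<bar>\<Delta>'\<bar> * K ^ Suc (L * ((1 + k) * D)) * (fact L * H ^ L) ^ d"
      by (rule liouville[OF _ \<open>\<Delta>' \<noteq> 0\<close>]) (unfold \<Delta>'_def, rule int_poly_value_fdet[OF entry])
    define \<rho> where "\<rho> = real S * c"
    have "1 \<le> \<rho>" using pos \<open>1 \<le> c\<close> by (simp add: \<rho>_def mult_ge1_I)
    define B where "B = (4 * \<rho> * W) ^ D"
    define M where "M = (\<lambda>i. (4 * \<rho>) ^ (i mod D) * exp (\<bar>real (i div D) * ln r\<bar> * (4 * \<rho>)))"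
    \<comment> \<open>With \<open>E = 4\<close> the gain is
      \<open>4 ^ (L * (L - 1) / 2) = (2 ^ (L - 1)) ^ L\<close>, so that an \<open>L\<close>-th root
      can be taken later.\<close>
    have "\<bar>\<Delta>\<bar> * 4 ^ \<Sum>{..<L} \<le> fact L * (\<Prod>i<L. M i)"
      unfolding \<Delta>_def
    proof (rule interpolation_fdet_bound)
      fix j assume "j < L"
      have "\<bar>x j\<bar> \<le> real (j mod S) + real (j div S) * \<bar>\<beta>\<bar>"
        unfolding x_def by (rule order.trans[OF abs_triangle_ineq]) (simp add: abs_mult)
      also have "\<dots> \<le> real S + real S * \<bar>\<beta>\<bar>"
        using idx[OF \<open>j < L\<close>] by (intro add_mono mult_right_mono) auto
      finally show "\<bar>x j\<bar> \<le> \<rho>" by (simp add: \<rho>_def c_def algebra_simps)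
    next
      fix i t
      show "(\<lambda>n. monom_exp_coeff (i mod D) (real (i div D) * ln r) n * t ^ n) sums f i t"
        unfolding f_def by (rule monom_exp_sums)
      show "(\<lambda>n. \<bar>monom_exp_coeff (i mod D) (real (i div D) * ln r) n\<bar> * (4 * \<rho>) ^ n) sums M i"
        unfolding M_def abs_monom_exp_coeff by (rule monom_exp_sums)
    qed (use \<open>1 \<le> \<rho>\<close> in auto)
    also have "(\<Prod>i<L. M i) \<le> (\<Prod>i<L. B)"
    proof (intro prod_mono conjI)
      fix i assume "i \<in> {..<L}"
      then have i: "i div D \<le> N" "i mod D \<le> D" using idx[of i] by auto
      have "\<bar>real (i div D) * ln r\<bar> * (4 * \<rho>) \<le> (real N * \<bar>ln r\<bar>) * (4 * \<rho>)"
        using i \<open>1 \<le> \<rho>\<close> by (intro mult_right_mono) (auto simp: abs_mult intro: mult_right_mono)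
      also have "\<dots> = real D * (4 * c * \<bar>ln r\<bar>)"
        unfolding \<rho>_def N_S[symmetric] by simp
      finally have "exp (\<bar>real (i div D) * ln r\<bar> * (4 * \<rho>)) \<le> W ^ D"
        unfolding W_def exp_of_nat_mult[symmetric] by simp
      moreover have "(4 * \<rho>) ^ (i mod D) \<le> (4 * \<rho>) ^ D"
        using i \<open>1 \<le> \<rho>\<close> by (intro power_increasing) auto
      ultimately show "M i \<le> B"
        unfolding M_def B_def power_mult_distrib[of "4 * \<rho>"] using \<open>1 \<le> \<rho>\<close> by (intro mult_mono) auto
      show "0 \<le> M i" using \<open>1 \<le> \<rho>\<close> by (simp add: M_def)
    qed
    finally have upper: "\<bar>\<Delta>\<bar> * 4 ^ \<Sum>{..<L} \<le> fact L * B ^ L" by simp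
    have gauss: "2 * \<Sum>{..<l} = l * (l - 1)" for l :: nat
    proof (induction l)
      case (Suc l)
      then show ?case by (cases l) auto
    qed simp
    define Z where "Z = K ^ Suc (L * ((1 + k) * D)) * (fact L * H ^ L) ^ d"
    \<comment> \<open>\<open>F\<close> and \<open>Y\<close> are chosen so that every bound is a
      power with exponent \<open>D * L\<close>: the factorial is at most \<open>F ^ L\<close>, and
      all factors together make up \<open>(Y ^ D) ^ L\<close>.\<close>
    define F where "F = (real N ^ 4) ^ D"
    define Y where "Y = real N ^ 4 * (4 * \<rho> * W) * real q * K ^ (2 + k) * (real N ^ 4 * real (2 * S * p * q)) ^ d"
    have nonneg: "0 \<le> Z" "0 \<le> H" "0 \<le> B" "0 \<le> F" "0 \<le> Y"
      using K \<open>1 \<le> \<rho>\<close> \<open>1 \<le> W\<close> by (auto simp: Z_def H_def B_def F_def Y_def)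
    have "real L = real N ^ 4" by (simp add: L_def D_def power_Suc[symmetric] del: power_Suc)
    also have "\<dots> \<le> F"
      unfolding F_def using N pos(2) by (intro self_le_power) auto
    finally have "real L ^ L \<le> F ^ L" by (intro power_mono) auto
    then have fact_le: "fact L \<le> F ^ L"
      using fact_le_power[of L, where 'a = real] by simp
    have "1 \<le> L * D" using pos by simp
    then have "Suc (L * ((1 + k) * D)) \<le> ((2 + k) * D) * L" by (simp add: algebra_simps)
    then have K_le: "K ^ Suc (L * ((1 + k) * D)) \<le> (K ^ ((2 + k) * D)) ^ L"
      unfolding power_mult[symmetric] using K by (intro power_increasing)
    have Z_le: "Z \<le> (K ^ ((2 + k) * D)) ^ L * (F ^ L * H ^ L) ^ d"
      unfolding Z_def using K_le fact_le nonneg K by (intro mult_mono power_mono mult_right_mono) auto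
    have "(2 ^ (L - 1)) ^ L = (4 :: real) ^ \<Sum>{..<L}"
      unfolding power_mult[symmetric] mult.commute[of "L - 1"] gauss[symmetric] by (simp add: power_mult)
    also have "\<dots> \<le> 4 ^ \<Sum>{..<L} * (\<bar>\<Delta>'\<bar> * Z)"
      using lower unfolding Z_def by (simp add: mult.assoc)
    also have "\<dots> = (\<bar>\<Delta>\<bar> * 4 ^ \<Sum>{..<L}) * ((real q ^ D) ^ L * Z)"
      by (simp add: \<Delta>' abs_mult)
    also have "\<dots> \<le> (fact L * B ^ L) * ((real q ^ D) ^ L * Z)"
      using upper nonneg by (intro mult_right_mono) auto
    also have "\<dots> \<le> (F ^ L * B ^ L) * ((real q ^ D) ^ L * ((K ^ ((2 + k) * D)) ^ L * (F ^ L * H ^ L) ^ d))"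
      using fact_le Z_le nonneg by (intro mult_mono mult_left_mono mult_right_mono) auto
    also have "\<dots> = (F * B * real q ^ D * K ^ ((2 + k) * D) * (F * H) ^ d) ^ L"
      by (simp only: power_mult_distrib power_mult[symmetric] mult.assoc mult.commute[of d L])
    also have "F * B * real q ^ D * K ^ ((2 + k) * D) * (F * H) ^ d = Y ^ D"
      unfolding F_def B_def H_def Y_def
      by (simp only: power_mult_distrib power_mult[symmetric] mult.assoc mult.commute[of d D])
    finally have "2 ^ (L - 1) \<le> Y ^ D"
      using pos(3) nonneg by (subst (asm) power_mono_iff) auto
    moreover have "(2 ^ (N - 1)) ^ D \<le> (2 :: real) ^ (L - 1)"
    proof -
      have "(N - 1) * D \<le> L - 1"
        using pos(2) unfolding L_def diff_mult_distrib by simp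
      then show ?thesis unfolding power_mult[symmetric] by (intro power_increasing) auto
    qed
    ultimately have "(2 ^ (N - 1)) ^ D \<le> Y ^ D" by linarith
    then have "2 ^ (N - 1) \<le> Y"
      using pos(2) nonneg by (subst (asm) power_mono_iff) auto
    \<comment> \<open>Each \<open>S = N ^ 2\<close> next to a factor \<open>N ^ 4\<close> gives
      \<open>N ^ 6\<close>: once from \<open>\<rho>\<close> and \<open>d\<close> times from the
      lengths of the entries.\<close>
    also have "Y = Q * real N ^ (6 + 6 * d)"
    proof -
      have e1: "real N ^ 4 * real (2 * S * p * q) = real N ^ 6 * (2 * real p * real q)"
        by (simp add: S_def power_add[symmetric] flip: mult.assoc)
      have e2: "real N ^ 4 * (4 * \<rho> * W) = real N ^ 6 * (4 * c * W)"
        by (simp add: \<rho>_def S_def power_add[symmetric] flip: mult.assoc)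
      show ?thesis
        unfolding Y_def Q_def e1 e2 by (simp add: power_mult_distrib power_add power_mult)
    qed
    finally show ?thesis .
  qed
  moreover obtain N where "N \<ge> 1" "Q * real N ^ (6 + 6 * d) < 2 ^ (N - 1)"
    using power_mult_pow2_unbounded by blast
  ultimately show False by force
qed

subsection \<open>Iterated exponentials\<close>

lemma tower_limit_fixpoint:
  assumes "0 < x" "tower x \<longlonglongrightarrow> h"
  shows "x powr h = h"
proof (rule LIMSEQ_unique[symmetric])
  show "(\<lambda>n. tower x (Suc n)) \<longlonglongrightarrow> h" using assms(2) by (rule LIMSEQ_Suc)
  show "(\<lambda>n. tower x (Suc n)) \<longlonglongrightarrow> x powr h"
    unfolding tower.simps using assms by (intro tendsto_powr tendsto_const) auto
qed

text \<open>The tower increases, and it stays at most \<open>e\<close> since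
  \<open>t \<le> e\<close> implies \<open>x powr t \<le> e\<close> for these
  \<open>x\<close>.\<close>

lemma tower_tendsto_ge_1:
  assumes "1 \<le> x" "x \<le> exp (1 / exp 1)"
  shows "\<exists>h. tower x \<longlonglongrightarrow> h \<and> 1 \<le> h \<and> h \<le> exp 1"
proof -
  have x_le: "x powr t \<le> exp 1" if "t \<le> exp 1" for t
  proof -
    have "x powr t \<le> x powr exp 1" using assms that by (intro powr_mono)
    also have "\<dots> \<le> exp (1 / exp 1) powr exp 1" using assms by (intro powr_mono2) auto
    also have "\<dots> = exp 1" by (simp add: powr_def)
    finally show ?thesis .
  qed
  have le: "tower x n \<le> exp 1" for n
  proof (induction n)
    case 0
    then show ?case using x_le[of 1] assms by simp
  qed (simp add: x_le)
  have inc: "tower x n \<le> tower x (Suc n)" for n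
  proof (induction n)
    case 0
    then show ?case using powr_mono[of 1 x x] assms by simp
  next
    case (Suc n)
    then show ?case using powr_mono[of "tower x n" "tower x (Suc n)" x] assms by simp
  qed
  have "incseq (tower x)" by (rule incseq_SucI) (rule inc)
  then obtain h where h: "tower x \<longlonglongrightarrow> h" "\<And>n. tower x n \<le> h"
    using incseq_convergent[of "tower x" "exp 1"] le by metis
  have "1 \<le> h" using h(2)[of 0] assms(1) by simp
  moreover have "h \<le> exp 1" using LIMSEQ_le_const2[OF h(1)] le by blast
  ultimately show ?thesis using h(1) by blast
qed

text \<open>With \<open>c = - ln x\<close> and \<open>v = c * x powr t\<close> the derivative of \<open>t \<mapsto> x powr (x powr t)\<close> is
  \<open>c * v * exp (- v)\<close>, which is at most \<open>c / e \<le> 1\<close>, with equality for at most one \<open>t\<close>.\<close>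

lemma powr_powr_fixpoint_unique:
  fixes x :: real
  assumes x: "exp (- exp 1) \<le> x" "x < 1"
    and ab: "x powr (x powr a) = a" "x powr (x powr b) = b"
  shows "a = b"
proof -
  have "0 < x" using x(1) by (rule less_le_trans[OF exp_gt_zero])
  define c where "c = - ln x"
  have c: "0 < c" "c \<le> exp 1"
    using x \<open>0 < x\<close> ln_ge_iff[of x "- exp 1"] by (auto simp: c_def)
  define v where "v = (\<lambda>t. c * x powr t)"
  define \<phi> where "\<phi> = (\<lambda>t. x powr (x powr t) - t)"
  define \<phi>' where "\<phi>' = (\<lambda>t. c * (v t * exp (- v t)) - 1)"
  have v_pos: "0 < v t" for t using c \<open>0 < x\<close> by (simp add: v_def)
  have deriv: "(\<phi> has_real_derivative \<phi>' t) (at t)" for t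
    unfolding \<phi>_def \<phi>'_def v_def c_def powr_def using \<open>0 < x\<close>
    by (auto intro!: derivative_eq_intros simp: algebra_simps)
  have bound: "c * (v t * exp (- v t)) \<le> exp 1 * (v t * exp (- v t))" for t
    using c v_pos[of t] by (intro mult_right_mono) auto
  \<comment> \<open>As \<open>ln v \<le> v - 1\<close> with equality only at \<open>v = 1\<close>,
    this form shows that \<open>\<phi>' \<le> 0\<close> and that \<open>\<phi>'\<close> can vanish
    only where \<open>v = 1\<close>.\<close>
  have eq: "exp 1 * (v t * exp (- v t)) = exp (ln (v t) - (v t - 1))" for t
    using v_pos[of t] by (simp add: exp_diff exp_add exp_minus field_simps)
  have nonpos: "\<phi>' t \<le> 0" for t
    using bound[of t] ln_le_minus_one[OF v_pos[of t]] unfolding \<phi>'_def eq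
    by (smt (verit) exp_le_one_iff)
  have v1: "v t = 1" if "\<phi>' t = 0" for t
  proof -
    have "1 \<le> exp (ln (v t) - (v t - 1))" using that bound[of t] unfolding \<phi>'_def eq by simp
    then have "ln (v t) = v t - 1" using ln_le_minus_one[OF v_pos[of t]] by simp
    then show ?thesis using ln_eq_minus_one v_pos by blast
  qed
  \<comment> \<open>A nonincreasing \<open>\<phi>\<close> with two zeros also vanishes at their
    midpoint; the mean value theorem on both halves yields two points with \<open>v = 1\<close>, but
    \<open>v\<close> is strictly decreasing.\<close>
  have aux: False if "a < b" "\<phi> a = 0" "\<phi> b = 0" for a b
  proof -
    define m where "m = (a + b) / 2"
    have m: "a < m" "m < b" using that by (auto simp: m_def)
    have dec: "\<phi> t \<le> \<phi> s" if "s \<le> t" for s t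
      using DERIV_nonpos_imp_nonincreasing[OF that, of \<phi>] deriv nonpos by blast
    have "\<phi> m = 0" using dec[of a m] dec[of m b] m that by simp
    obtain z where z: "a < z" "z < m" "\<phi> m - \<phi> a = (m - a) * \<phi>' z"
      using MVT2[OF m(1), of \<phi> \<phi>'] deriv by blast
    obtain z' where z': "m < z'" "z' < b" "\<phi> b - \<phi> m = (b - m) * \<phi>' z'"
      using MVT2[OF m(2), of \<phi> \<phi>'] deriv by blast
    have "v z = v z'" using v1[of z] v1[of z'] z z' m that \<open>\<phi> m = 0\<close> by simp
    moreover have "x powr z' < x powr z"
      using x \<open>0 < x\<close> z z' by (intro powr_less_mono') auto
    ultimately show False using c by (simp add: v_def)
  qed
  have "\<phi> a = 0" "\<phi> b = 0" using ab by (auto simp: \<phi>_def)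
  with aux[of a b] aux[of b a] show ?thesis by (meson linorder_neqE)
qed

text \<open>As \<open>t \<mapsto> x powr t\<close> is decreasing, its second iterate
  \<open>G\<close> is increasing. The even terms increase, the odd ones decrease, and both limits
  are fixed points of \<open>G\<close>, hence equal.\<close>

lemma tower_tendsto_less_1:
  assumes x: "exp (- exp 1) \<le> x" "x < 1"
  shows "\<exists>h. tower x \<longlonglongrightarrow> h \<and> 0 \<le> h \<and> h \<le> 1"
proof -
  have "0 < x" using x(1) by (rule less_le_trans[OF exp_gt_zero])
  define G where "G = (\<lambda>t. x powr (x powr t))"
  have anti: "x powr t \<le> x powr s" if "s \<le> t" for s t
    using that x \<open>0 < x\<close> by (intro powr_mono') auto
  have G_mono: "G s \<le> G t" if "s \<le> t" for s t
    using that by (simp add: G_def anti)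
  have pos: "0 < tower x n" for n by (cases n) (use \<open>0 < x\<close> in auto)
  have le1: "tower x n \<le> 1" for n
    using x \<open>0 < x\<close> pos anti[of 0] by (cases n) (auto simp: less_imp_le)
  have lim_fix: "G l = l" if "(\<lambda>n. tower x (2 * n + i)) \<longlonglongrightarrow> l" for l i
  proof (rule LIMSEQ_unique)
    show "(\<lambda>n. tower x (2 * Suc n + i)) \<longlonglongrightarrow> l" using that by (rule LIMSEQ_Suc)
    have "(\<lambda>n. G (tower x (2 * n + i))) \<longlonglongrightarrow> G l"
      unfolding G_def using \<open>0 < x\<close> that by (intro tendsto_powr tendsto_const) auto
    then show "(\<lambda>n. tower x (2 * Suc n + i)) \<longlonglongrightarrow> G l"
      by (simp add: G_def)
  qed
  have inc: "tower x (2 * n) \<le> tower x (2 * Suc n)" for n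
  proof (induction n)
    case 0
    have "x powr 1 \<le> x powr (x powr x)" using anti[of "x powr x" 1] le1[of 1] by simp
    then show ?case using \<open>0 < x\<close> by (simp add: numeral_2_eq_2)
  next
    case (Suc n)
    then show ?case using G_mono[OF Suc] by (simp add: G_def)
  qed
  have dec: "tower x (2 * Suc n + 1) \<le> tower x (2 * n + 1)" for n
  proof (induction n)
    case 0
    have "x powr 1 \<le> x powr (x powr x)" using anti[of "x powr x" 1] le1[of 1] by simp
    then have "x \<le> x powr (x powr x)" using \<open>0 < x\<close> by simp
    then show ?case using anti by (simp add: numeral_2_eq_2)
  next
    case (Suc n)
    then show ?case using G_mono[OF Suc] by (simp add: G_def)
  qed
  have "incseq (\<lambda>n. tower x (2 * n))" by (rule incseq_SucI) (rule inc)
  then obtain l where l: "(\<lambda>n. tower x (2 * n)) \<longlonglongrightarrow> l"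
    using incseq_convergent[of "\<lambda>n. tower x (2 * n)" 1] le1 by metis
  have "decseq (\<lambda>n. tower x (2 * n + 1))" by (rule decseq_SucI) (rule dec)
  then obtain l' where l': "(\<lambda>n. tower x (2 * n + 1)) \<longlonglongrightarrow> l'"
    using decseq_convergent[of "\<lambda>n. tower x (2 * n + 1)" 0] pos less_imp_le by metis
  have "l = l'"
    using powr_powr_fixpoint_unique[OF x] lim_fix[of 0 l] lim_fix[of 1 l'] l l' by (simp add: G_def)
  then have "tower x \<longlonglongrightarrow> l"
    using limseq_even_odd[of "tower x", OF l] l' by (simp only:)
  moreover from this have "0 \<le> l" "l \<le> 1"
    using LIMSEQ_le_const[of "tower x" l 0] LIMSEQ_le_const2[of "tower x" l 1] pos le1 less_imp_le by blast+
  ultimately show ?thesis by blast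
qed

lemma iter_exp_properties:
  assumes x: "exp (- exp 1) \<le> x" "x \<le> exp (1 / exp 1)"
  shows "x powr iter_exp x = iter_exp x" "1 / exp 1 \<le> iter_exp x" "iter_exp x \<le> exp 1"
proof -
  have "0 < x" using x(1) by (rule less_le_trans[OF exp_gt_zero])
  have "\<exists>h. tower x \<longlonglongrightarrow> h \<and> 0 \<le> h \<and> h \<le> exp 1 \<and> (1 \<le> x \<longrightarrow> 1 \<le> h)"
  proof (cases "1 \<le> x")
    case True
    then show ?thesis using tower_tendsto_ge_1[OF True x(2)] by force
  next
    case False
    then obtain h where "tower x \<longlonglongrightarrow> h" "0 \<le> h" "h \<le> 1"
      using tower_tendsto_less_1[OF x(1)] by force
    moreover from this have "h \<le> exp 1" using order.trans[of h 1 "exp 1"] by simp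
    ultimately show ?thesis using False by blast
  qed
  then obtain h where h: "tower x \<longlonglongrightarrow> h" "0 \<le> h" "h \<le> exp 1" "1 \<le> x \<Longrightarrow> 1 \<le> h" by blast
  have fixpoint: "x powr h = h" by (rule tower_limit_fixpoint[OF \<open>0 < x\<close> h(1)])
  then have "0 < h" using \<open>0 < x\<close> powr_gt_zero[of x h] by simp
  have "1 / exp 1 \<le> h"
  proof (rule ccontr)
    \<comment> \<open>From \<open>ln h = h * ln x\<close> and \<open>ln x \<ge> - e\<close> follows
      \<open>ln h \<ge> - e * h > - 1\<close>, whereas \<open>h < 1 / e\<close> means
      \<open>ln h < - 1\<close>.\<close>
    assume "\<not> 1 / exp 1 \<le> h"
    then have less: "h < exp (- 1)" by (simp add: exp_minus inverse_eq_divide)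
    have "ln h = h * ln x" using arg_cong[OF fixpoint, of ln] \<open>0 < x\<close> by (simp add: ln_powr mult.commute)
    moreover have "- exp 1 \<le> ln x" using x(1) \<open>0 < x\<close> by (simp add: ln_ge_iff)
    ultimately have "h * (- exp 1) \<le> ln h" using \<open>0 < h\<close> by (simp only: mult_left_mono less_imp_le)
    moreover have "ln h < - 1" using less \<open>0 < h\<close> ln_less_cancel_iff[of h "exp (- 1)"] by simp
    moreover have "h * exp 1 < 1" using less by (simp add: exp_minus field_simps)
    ultimately show False by linarith
  qed
  moreover have "iter_exp x = h" unfolding iter_exp_def by (rule limI[OF h(1)])
  ultimately show "x powr iter_exp x = iter_exp x" "1 / exp 1 \<le> iter_exp x" "iter_exp x \<le> exp 1"
    using fixpoint h(3) by auto
qed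

subsection \<open>Rational values and the exceptional set\<close>

lemma ord_alg_eq_enatD:
  assumes "ord_alg A = enat k"
  shows "A ^ k \<in> \<rat>" "0 < k" "\<And>n. 0 < n \<Longrightarrow> A ^ n \<in> \<rat> \<Longrightarrow> k \<le> n"
proof -
  let ?P = "\<lambda>n. n \<ge> 1 \<and> A ^ n \<in> \<rat>"
  have ex: "\<exists>n. ?P n" and k: "k = (LEAST n. ?P n)"
    using assms by (auto simp: ord_alg_def split: if_splits)
  show "A ^ k \<in> \<rat>" "0 < k" using LeastI_ex[OF ex] unfolding k by auto
  show "k \<le> n" if "0 < n" "A ^ n \<in> \<rat>" for n
    unfolding k by (rule Least_le) (use that in auto)
qed

lemma ord_alg_dvd:
  assumes "ord_alg A = enat k" "A ^ n \<in> \<rat>" "A \<noteq> 0"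
  shows "k dvd n"
proof (rule ccontr)
  assume "\<not> k dvd n"
  then have pos: "0 < n mod k" by (simp add: mod_greater_zero_iff_not_dvd)
  have "A ^ n = (A ^ k) ^ (n div k) * A ^ (n mod k)"
    by (simp add: power_mult[symmetric] power_add[symmetric])
  then have "A ^ (n mod k) = A ^ n / (A ^ k) ^ (n div k)" using assms(3) by simp
  also have "\<dots> \<in> \<rat>" using assms(2) ord_alg_eq_enatD(1)[OF assms(1)] by (meson Rats_divide Rats_power)
  finally have "k \<le> n mod k" using ord_alg_eq_enatD(3)[OF assms(1) pos] by simp
  moreover have "n mod k < k" using ord_alg_eq_enatD(2)[OF assms(1)] by simp
  ultimately show False by simp
qed

text \<open>Bezout: \<open>b * u = t * v + 1\<close> gives
  \<open>h = h ^ (b * u) / h ^ (t * v) = (r ^ u / h ^ v) ^ t\<close>.\<close>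

lemma rational_coprime_root:
  fixes r h :: real
  assumes "r ^ t = h ^ b" "r \<in> \<rat>" "h \<in> \<rat>" "coprime b t" "0 < b" "0 < h" "0 < r"
  shows "\<exists>g\<in>\<rat>. 0 < g \<and> g ^ t = h"
proof -
  obtain u v where uv: "b * u = t * v + 1"
    using bezout_nat[of b t] assms(4,5) by auto
  have "h * h ^ (t * v) = h ^ (b * u)" by (simp add: uv)
  also have "\<dots> = (r ^ u) ^ t" using assms(1) by (metis mult.commute power_mult)
  finally have "(r ^ u / h ^ v) ^ t = h"
    using assms(6) by (simp add: power_divide power_mult[symmetric] mult.commute field_simps)
  then show ?thesis using assms by (intro bexI[of _ "r ^ u / h ^ v"]) auto
qed

lemma theta_pos: "0 < theta"
proof -
  have "(2 :: real) \<le> exp 1" using exp_ge_add_one_self[of 1] by simp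
  then have "1 / exp 1 \<le> (1 / 2 :: real)" by (intro divide_left_mono) auto
  moreover have "(2 / 3 :: real) \<le> ln 2" by (rule ln2_ge_two_thirds)
  ultimately have "1 / exp 1 < (ln 2 :: real)" by linarith
  then show ?thesis unfolding theta_def by simp
qed

text \<open>Since \<open>c \<ge> 2\<close>, \<open>t * ln 2 \<le> ln k + ln t\<close>, and
  \<open>ln t \<le> t / e\<close> absorbs the last term; \<open>theta\<close> is the reciprocal of
  the remaining factor \<open>ln 2 - 1 / e\<close>.\<close>

lemma exc_set_exponent_bound:
  assumes "k * t = c ^ t" "2 \<le> k" "0 < t"
  shows "real t \<le> theta * ln (real k)"
proof -
  have "2 \<le> c"
  proof (rule ccontr)
    assume "\<not> 2 \<le> c"
    then have "c ^ t \<le> 1" by (intro power_le_one) auto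
    moreover have "2 * 1 \<le> k * t" using assms by (intro mult_le_mono) auto
    ultimately show False using assms(1) by simp
  qed
  have "ln (real k) + ln (real t) = ln (real (k * t))"
    using assms(2,3) by (simp add: ln_mult)
  also have "\<dots> = real t * ln (real c)"
    unfolding assms(1) using \<open>2 \<le> c\<close> by (simp add: ln_realpow)
  also have "\<dots> \<ge> real t * ln 2" using \<open>2 \<le> c\<close> by (intro mult_left_mono) auto
  finally have 1: "real t * ln 2 \<le> ln (real k) + ln (real t)" .
  have "ln (real t / exp 1) \<le> real t / exp 1 - 1"
    using assms(3) by (intro ln_le_minus_one) auto
  then have "ln (real t) \<le> real t / exp 1" using assms(3) by (simp add: ln_div)
  with 1 have "real t * (ln 2 - 1 / exp 1) \<le> ln (real k)" by (simp add: algebra_simps)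
  moreover have "0 < ln 2 - 1 / exp (1 :: real)" using theta_pos by (simp add: theta_def)
  ultimately show ?thesis unfolding theta_def by (simp add: field_simps)
qed

lemma rational_iter_exp_imp_exc_set:
  fixes A h :: real
  assumes k: "2 \<le> k" "ord_alg A = enat k" and "0 < A" "h \<in> \<rat>"
    and h: "A powr h = h" "1 / exp 1 \<le> h" "h \<le> exp 1"
  shows "A \<in> exc_set k"
proof -
  have "0 < h" using h(1) \<open>0 < A\<close> powr_gt_zero[of A h] by simp
  obtain a b :: nat where ab: "b \<noteq> 0" "\<bar>h\<bar> = real a / real b" "coprime a b"
    using Rats_abs_nat_div_natE[OF \<open>h \<in> \<rat>\<close>] by metis
  then have h_eq: "h = real a / real b" and "0 < a" "0 < b"
    using \<open>0 < h\<close> by (auto intro!: gr0I)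
  have Aa: "A ^ a = h ^ b"
  proof -
    have "h ^ b = (A powr h) powr real b" using h(1) \<open>0 < h\<close> by (simp add: powr_realpow)
    also have "\<dots> = A powr real a" using \<open>0 < b\<close> by (simp add: powr_powr h_eq)
    finally show ?thesis using \<open>0 < A\<close> by (simp add: powr_realpow)
  qed
  then have "k dvd a"
    using ord_alg_dvd[OF k(2)] \<open>h \<in> \<rat>\<close> \<open>0 < A\<close> by (metis Rats_power less_irrefl)
  then obtain t where t: "a = k * t" by (elim dvdE)
  have "0 < t" using \<open>0 < a\<close> t by (cases t) auto
  have "(A ^ k) ^ t = h ^ b" using Aa by (simp add: t power_mult)
  moreover have "coprime b t" using ab(3) unfolding t by (simp add: coprime_commute)
  ultimately obtain g where g: "g \<in> \<rat>" "0 < g" "g ^ t = h"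
    using rational_coprime_root[of "A ^ k" t h b] ord_alg_eq_enatD(1)[OF k(2)] \<open>h \<in> \<rat>\<close>
      \<open>0 < A\<close> \<open>0 < h\<close> \<open>0 < b\<close> by auto
  obtain c e :: nat where ce: "e \<noteq> 0" "\<bar>g\<bar> = real c / real e" "coprime c e"
    using Rats_abs_nat_div_natE[OF g(1)] by metis
  have "real c ^ t / real e ^ t = real a / real b"
    using g ce h_eq by (simp add: power_divide[symmetric])
  then have "real (a * e ^ t) = real (c ^ t * b)"
    using ce(1) \<open>0 < b\<close> by (simp add: field_simps)
  then have "a * e ^ t = c ^ t * b" by (simp only: of_nat_eq_iff)
  \<comment> \<open>Both fractions are in lowest terms, so numerators and denominators agree; this
    yields the two root conditions of \<open>exc_set\<close>.\<close>
  then have ace: "a = c ^ t" and bce: "b = e ^ t"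
    using coprime_crossproduct_nat[of a b "c ^ t" "e ^ t"] ab(3) ce(3) by auto
  show ?thesis
    unfolding exc_set_def mem_Collect_eq
  proof (rule exI[of _ b], rule exI[of _ t], intro conjI)
    \<comment> \<open>Solving the fixed point equation for \<open>A\<close> gives the defining form
      of the exceptional numbers, with the denominator \<open>b\<close> of \<open>h\<close> as
      \<open>s\<close>.\<close>
    have "h powr (1 / h) = A" using h(1) \<open>0 < A\<close> \<open>0 < h\<close>
      powr_powr[of A h "1 / h"] by simp
    then show "A = (real (k * t) / real b) powr (real b / real (k * t))"
      unfolding t[symmetric] by (simp add: h_eq)
    show "real t \<le> theta * ln (real k)"
      by (rule exc_set_exponent_bound[OF _ k(1) \<open>0 < t\<close>]) (use ace t in simp)
    show "real (k * t) / exp 1 \<le> real b" "real b \<le> real (k * t) * exp 1"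
      using h(2,3) \<open>0 < b\<close> unfolding t[symmetric] h_eq by (simp_all add: field_simps)
    show "root t (real (k * t)) \<in> \<nat>" "root t (real b) \<in> \<nat>"
      unfolding t[symmetric] unfolding ace bce using \<open>0 < t\<close> by (simp_all add: real_root_power_cancel)
    show "gcd (k * t) b = 1" using ab(3) unfolding t[symmetric] by simp
  qed (use \<open>0 < b\<close> \<open>0 < t\<close> in auto)
qed

section \<open>Rational and irrational values combined\<close>

theorem theorem2p1:
  fixes k :: nat and A :: real
  assumes "k \<ge> 2"
    and "algebraic A"
    and "exp (- exp 1) \<le> A" and "A \<le> exp (1 / exp 1)"
    and "ord_alg A = enat k"
    and "A \<notin> exc_set k"
  shows "\<not> algebraic (iter_exp A)"
proof
  define h where "h = iter_exp A"
  assume "algebraic (iter_exp A)"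
  then have alg: "algebraic h" by (simp add: h_def)
  have "0 < A" using assms(3) by (rule less_le_trans[OF exp_gt_zero])
  note h = iter_exp_properties[OF assms(3,4), folded h_def]
  have "0 < h" using h(1) \<open>0 < A\<close> powr_gt_zero[of A h] by simp
  have irrational: "h \<notin> \<rat>"
    using rational_iter_exp_imp_exc_set[OF assms(1,5) \<open>0 < A\<close> _ h] assms(6) by blast
  \<comment> \<open>A positive \<open>A\<close> with \<open>A ^ k = 1\<close> is 1 itself, whose
    order is 1 and not \<open>k \<ge> 2\<close>.\<close>
  have "A ^ k \<noteq> 1"
  proof
    assume "A ^ k = 1"
    then have "A = 1" using \<open>0 < A\<close> assms(1) power_eq_iff_eq_base[of k A 1] by simp
    then show False using ord_alg_eq_enatD(3)[OF assms(5), of 1] assms(1) by simp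
  qed
  moreover have "(A ^ k) powr h = h ^ k"
  proof -
    have "(A ^ k) powr h = (A powr h) ^ k"
      using \<open>0 < A\<close> by (simp add: powr_realpow[symmetric] powr_powr mult.commute)
    then show ?thesis using h(1) by simp
  qed
  ultimately show False
    using rational_powr_neq_power[OF ord_alg_eq_enatD(1)[OF assms(5)] _ _ alg irrational] \<open>0 < A\<close> by auto
qed

end
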